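(* Let $q=3^{2e}$ with $e\ge 1$, $E=\mathbb{F}_{q^3}$, $F=\mathbb{F}_q$, $\mathrm{Tr}:E\to F$ the relative trace, $N=q^2+q+1$, $\omega$ a primitive element of $E$, and $w_1\in E$ an element of order $N$. Model $\mathrm{AG}(2,q)$ as follows: identify the point $\langle w_1^i\rangle$ of $\mathrm{PG}(2,q)$ (with underlying $F$-space $E$) with $i\in\mathbb{Z}_N$; let $J=\{i\in\mathbb{Z}_N:\mathrm{Tr}(w_1^i)=0\}$; the points of $\mathrm{AG}(2,q)$ are the elements of $\mathbb{Z}_N\setminus J$ and the lines are $\ell_i=\{j\in\mathbb{Z}_N\setminus J:\mathrm{Tr}(w_1^{i+j})=0\}$, $1\le i\le N-1$. Let $w_0=\omega^N\in F$ and $C_k^{(4,q)}=w_0^k\langle w_0^4\rangle$ for $0\le k\le 3$. Then $$\mathcal K=\{k\in\mathbb{Z}_N:\mathrm{Tr}(w_1^k)\in C_0^{(4,q)}\cup C_1^{(4,q)}\}\subseteq\mathbb{Z}_N\setminus J$$ is a set of type $\left(\tfrac12(3^{2e}-3^e),\tfrac12(3^{2e}+3^e)\right)$ in $\mathrm{AG}(2,3^{2e})$.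
   Context: A set $\mathcal K$ of points of an affine plane is a set of type $(m,n)$ ($m<n$) if every line meets $\mathcal K$ in either $m$ or $n$ points, and both values occur. *)

theory Defs
  imports Complex_Main "HOL-Library.Cardinality"
begin

definition is_subfield :: "'a::field set \<Rightarrow> bool" where
  "is_subfield F \<longleftrightarrow> 0 \<in> F \<and> 1 \<in> F \<and>
     (\<forall>x\<in>F. \<forall>y\<in>F. x + y \<in> F \<and> x * y \<in> F) \<and>
     (\<forall>x\<in>F. - x \<in> F \<and> inverse x \<in> F)"

text \<open>The relative trace from a finite field to its subfield \<open>F\<close>, where \<open>d\<close> is the degree of
  the extension: the sum of the conjugates \<open>x, x^q, \<dots>, x^(q^(d-1))\<close> with \<open>q = card F\<close>.\<close>

definition rel_trace :: "'a::field set \<Rightarrow> nat \<Rightarrow> 'a \<Rightarrow> 'a" where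
  "rel_trace F d x = (\<Sum>i<d. x ^ (card F ^ i))"

definition has_mult_order :: "'a::field \<Rightarrow> nat \<Rightarrow> bool" where
  "has_mult_order x n \<longleftrightarrow> 0 < n \<and> x ^ n = 1 \<and> (\<forall>m. 0 < m \<and> m < n \<longrightarrow> x ^ m \<noteq> 1)"

text \<open>Natural exponents suffice here and in \<open>cyclotomic_class\<close>, as the multiplicative group of
  the field is finite.\<close>

definition primitive_element :: "'a::{field,finite} \<Rightarrow> bool" where
  "primitive_element w \<longleftrightarrow> range (\<lambda>n::nat. w ^ n) = UNIV - {0}"

definition cyclotomic_class :: "nat \<Rightarrow> 'a::{field,finite} \<Rightarrow> nat \<Rightarrow> 'a set" where
  "cyclotomic_class n g k = {g ^ k * (g ^ n) ^ j | j::nat. True}"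

text \<open>The cyclic model of the affine plane: \<open>Tr\<close> is the trace, \<open>w\<close> has multiplicative order \<open>N\<close>,
  and the index \<open>i < N\<close> (a residue modulo \<open>N\<close>) stands for the projective point spanned by \<open>w ^ i\<close>.
  The points at infinity are those with trace zero. The sum \<open>i + j\<close> in \<open>ag_line\<close> need not be
  reduced modulo \<open>N\<close>, since \<open>w ^ N = 1\<close>.\<close>

definition ag_infinity :: "('a::field \<Rightarrow> 'a) \<Rightarrow> nat \<Rightarrow> 'a \<Rightarrow> nat set" where
  "ag_infinity Tr N w = {i \<in> {..<N}. Tr (w ^ i) = 0}"

definition ag_points :: "('a::field \<Rightarrow> 'a) \<Rightarrow> nat \<Rightarrow> 'a \<Rightarrow> nat set" where
  "ag_points Tr N w = {..<N} - ag_infinity Tr N w"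

definition ag_line :: "('a::field \<Rightarrow> 'a) \<Rightarrow> nat \<Rightarrow> 'a \<Rightarrow> nat \<Rightarrow> nat set" where
  "ag_line Tr N w i = {j \<in> ag_points Tr N w. Tr (w ^ (i + j)) = 0}"

definition ag_lines :: "('a::field \<Rightarrow> 'a) \<Rightarrow> nat \<Rightarrow> 'a \<Rightarrow> nat set set" where
  "ag_lines Tr N w = ag_line Tr N w ` {1..N - 1}"

definition set_of_type :: "'p set \<Rightarrow> 'p set set \<Rightarrow> nat \<Rightarrow> nat \<Rightarrow> 'p set \<Rightarrow> bool" where
  "set_of_type P L m n K \<longleftrightarrow> m < n \<and> K \<subseteq> P \<and>
     (\<forall>l\<in>L. card (l \<inter> K) = m \<or> card (l \<inter> K) = n) \<and>
     (\<exists>l\<in>L. card (l \<inter> K) = m) \<and> (\<exists>l\<in>L. card (l \<inter> K) = n)"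

end

theory Submission
  imports Defs "HOL-Library.Product_Plus" "HOL-Computational_Algebra.Polynomial"
begin

text \<open>
  Let \<open>\<chi>\<close> be the quartic character of \<open>E\<close> with \<open>\<chi> \<omega> = \<i>\<close>. Since \<open>w\<^sub>1\<close> is a fourth power, the affine point \<open>j\<close>, represented
  by \<open>x = w\<^sub>1 ^ j / Tr (w\<^sub>1 ^ j)\<close>, lies in \<open>K\<close> iff \<open>\<chi> x\<close> is \<open>1\<close> or \<open>\<i>\<close>, and a line corresponds to a set
  \<open>{d (a + t) | t \<in> F}\<close> with \<open>a \<notin> F\<close>. So it suffices to show that \<open>B = \<Sum>\<^sub>t \<chi> (a + t)\<close> is \<open>3 ^ e\<close> times a
  unit of \<open>\<int>[\<i>]\<close>.

  The L-function of \<open>B\<close> is \<open>1 + B T + C T\<^sup>2\<close> with \<open>C\<close> the sum of \<open>\<chi>\<close> over the monic quadratics evaluated at \<open>a\<close>.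
  Hence \<open>B\<^sup>3 - 3 B C\<close> is the sum of \<open>\<chi> (y + a) \<chi> (y + a ^ q) \<chi> (y + a ^ (q\<^sup>2))\<close> over all \<open>y \<in> E\<close>; as the three
  roots are rational over \<open>E\<close>, this is \<open>\<plusminus> 2\<close> times a unit times a Jacobi sum of modulus \<open>q ^ (3/2)\<close>. Moreover
  \<open>\<bar>C\<bar> = q\<close>. The prime \<open>3\<close> is inert in \<open>\<int>[\<i>]\<close>, so \<open>C\<close> and the Jacobi sum are powers of \<open>3\<close> up to units; the cubic
  equation then gives \<open>B = 3 ^ e x\<close> with \<open>\<bar>x\<bar> \<le> 2\<close>, and \<open>x\<close> is odd because \<open>B\<close> is a sum of \<open>q\<close> units.

  Both intersection numbers occur since the sum of the excesses over all lines is \<open>\<plusminus> q (q + 1)\<close>.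
\<close>

section \<open>Finite fields and fibre sums\<close>

text \<open>The fibres of an additive map are translates of one another, so they all have the same
  size.\<close>

lemma card_additive_fibre:
  fixes f :: "'a::{ab_group_add,finite} \<Rightarrow> 'b::ab_group_add"
  assumes add: "\<And>x y. f (x + y) = f x + f y" and "range f = T" and "t \<in> T"
  shows "card {x. f x = t} * card T = CARD('a)"
proof -
  have fin: "finite T" using assms(2) by auto
  have eq: "card {x. f x = s} = card {x. f x = t}" if "s \<in> T" for s
  proof -
    obtain x0 where x0: "f x0 = t - s"
    proof -
      obtain a b where "f a = t" "f b = s" using assms(2,3) \<open>s \<in> T\<close> by (metis imageE)
      moreover have "f (a - b) + f b = f a" by (simp flip: add)
      ultimately have "f (a - b) = t - s" by (simp add: algebra_simps)
      then show ?thesis using that by blast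
    qed
    have "bij_betw (\<lambda>x. x + x0) {x. f x = s} {x. f x = t}"
    proof (rule bij_betw_byWitness[where f' = "\<lambda>x. x - x0"])
      show "(\<lambda>x. x - x0) ` {x. f x = t} \<subseteq> {x. f x = s}"
      proof clarify
        fix x assume "t = f x"
        moreover have "f (x - x0) + f x0 = f x" by (simp flip: add)
        ultimately show "f (x - x0) = s" using x0 by (simp add: algebra_simps)
      qed
    qed (auto simp: add x0)
    then show ?thesis by (rule bij_betw_same_card)
  qed
  have "CARD('a) = card (\<Union>s\<in>T. {x. f x = s})"
    using assms(2) by (auto intro!: arg_cong[of _ _ card])
  also have "\<dots> = (\<Sum>s\<in>T. card {x. f x = s})"
    by (rule card_UN_disjoint) (use fin in auto)
  also have "\<dots> = card {x. f x = t} * card T"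
    using eq by simp
  finally show ?thesis by simp
qed

lemma sum_over_fibres:
  fixes h :: "'c \<Rightarrow> 'b::comm_semiring_1"
  assumes "finite A" and "finite T" and "f ` A \<subseteq> T"
  shows "(\<Sum>x\<in>A. h (f x)) = (\<Sum>t\<in>T. of_nat (card {x\<in>A. f x = t}) * h t)"
proof -
  have "(\<Sum>x\<in>A. h (f x)) = (\<Sum>t\<in>T. \<Sum>x\<in>{x\<in>A. f x = t}. h (f x))"
    using sum.group[OF assms, of "\<lambda>x. h (f x)"] by simp
  also have "\<dots> = (\<Sum>t\<in>T. of_nat (card {x\<in>A. f x = t}) * h t)"
    by (intro sum.cong) auto
  finally show ?thesis .
qed

text \<open>The powers below the least positive exponent \<open>m\<close> with
  \<open>w ^ m = 1\<close> are distinct and exhaust all powers, so \<open>m\<close> is the number of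
  nonzero elements.\<close>

lemma primitive_element_order:
  fixes w :: "'a::{field,finite}"
  assumes "primitive_element w"
  shows "has_mult_order w (CARD('a) - 1)"
proof -
  have R: "range (\<lambda>n::nat. w ^ n) = UNIV - {0}"
    using assms by (simp add: primitive_element_def)
  have w0: "w \<noteq> 0"
    using R by (metis Diff_iff insertI1 power_one_right rangeI)
  obtain i j :: nat where ij: "i < j" "w ^ i = w ^ j"
  proof -
    have "\<not> inj (\<lambda>n::nat. w ^ n)"
      using finite_imageD[of "\<lambda>n::nat. w ^ n" UNIV] by auto
    then show ?thesis using that unfolding inj_def by (metis linorder_neqE_nat)
  qed
  have ex: "0 < j - i \<and> w ^ (j - i) = 1"
    using ij w0 by (simp add: power_diff)
  define m where "m = (LEAST m. 0 < m \<and> w ^ m = 1)"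
  have m: "0 < m" "w ^ m = 1"
    using LeastI[of "\<lambda>m. 0 < m \<and> w ^ m = 1", OF ex] by (auto simp: m_def)
  have least: "w ^ k \<noteq> 1" if "0 < k" "k < m" for k
    using not_less_Least[of k "\<lambda>m. 0 < m \<and> w ^ m = 1"] that by (auto simp: m_def)
  have "range (\<lambda>n::nat. w ^ n) = (\<lambda>n. w ^ n) ` {..<m}"
  proof -
    have "w ^ n = w ^ (n mod m)" for n
    proof -
      have "w ^ n = w ^ (m * (n div m) + n mod m)" by simp
      then show ?thesis using m by (simp only: power_add power_mult power_one mult_1)
    qed
    then show ?thesis using m(1) by (fastforce simp: image_iff)
  qed
  moreover have "inj_on (\<lambda>n. w ^ n) {..<m}"
  proof (rule linorder_inj_onI')
    fix i j assume "i \<in> {..<m}" "j \<in> {..<m}" "i < j"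
    then have "w ^ (j - i) \<noteq> 1" using least[of "j - i"] by auto
    then show "w ^ i \<noteq> w ^ j" using \<open>i < j\<close> w0 by (auto simp: power_diff)
  qed
  ultimately have "card (UNIV - {0::'a}) = m"
    using R card_image[of "\<lambda>n. w ^ n" "{..<m}"] by auto
  then have "m = CARD('a) - 1" by (simp add: card_Diff_subset)
  then show ?thesis using m least by (auto simp: has_mult_order_def)
qed

lemma has_mult_order_power_eq_1_iff:
  assumes "has_mult_order w n"
  shows "w ^ k = 1 \<longleftrightarrow> n dvd k"
proof
  have n: "0 < n" "w ^ n = 1" and least: "\<And>m. 0 < m \<Longrightarrow> m < n \<Longrightarrow> w ^ m \<noteq> 1"
    using assms by (auto simp: has_mult_order_def)
  assume "w ^ k = 1"
  moreover have "w ^ k = w ^ (n * (k div n) + k mod n)" by simp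
  ultimately have "w ^ (k mod n) = 1" using n by (simp only: power_add power_mult power_one mult_1)
  then have "k mod n = 0" using least[of "k mod n"] n by (metis gr0I mod_less_divisor)
  then show "n dvd k" by auto
next
  assume "n dvd k"
  then show "w ^ k = 1" using assms by (auto simp: has_mult_order_def power_mult)
qed

text \<open>Translation by 1 permutes the field, so the sum of all elements is unchanged when
  \<open>CARD('a)\<close> ones are added to it. Hence a power of 3 vanishes in the field.\<close>

lemma three_eq_0:
  assumes "CARD('a::{field,finite}) = 3 ^ n"
  shows "(3::'a) = 0"
proof -
  have "(\<Sum>x\<in>UNIV. x) = (\<Sum>x\<in>UNIV. x + 1 :: 'a)"
    by (rule sum.reindex_bij_witness[of _ "\<lambda>x. x + 1" "\<lambda>x. x - 1"]) auto
  then have "of_nat (CARD('a)) = (0::'a)" by (simp add: sum.distrib)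
  then show ?thesis using assms by simp
qed

lemma frobenius_3:
  assumes "(3::'a::field) = 0"
  shows "(x + y :: 'a) ^ (3 ^ n) = x ^ (3 ^ n) + y ^ (3 ^ n)"
proof (induction n)
  case (Suc n)
  have cube: "(a + b) ^ 3 = a ^ 3 + b ^ 3" for a b :: 'a
  proof -
    have "(a + b) ^ 3 = a ^ 3 + b ^ 3 + 3 * (a ^ 2 * b + a * b ^ 2)"
      by (simp add: power2_eq_square power3_eq_cube algebra_simps)
    then show ?thesis by (simp add: assms)
  qed
  have "z ^ (3 ^ Suc n) = (z ^ (3 ^ n)) ^ 3" for z :: 'a by (simp add: mult.commute flip: power_mult)
  then show ?case by (simp only: Suc cube)
qed simp

section \<open>Gaussian integers\<close>

definition gauss_int :: "complex set" where
  "gauss_int = {z. Re z \<in> \<int> \<and> Im z \<in> \<int>}"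

lemma gauss_int_closed:
  "x \<in> gauss_int \<Longrightarrow> y \<in> gauss_int \<Longrightarrow> x + y \<in> gauss_int"
  "x \<in> gauss_int \<Longrightarrow> y \<in> gauss_int \<Longrightarrow> x * y \<in> gauss_int"
  "0 \<in> gauss_int" "1 \<in> gauss_int" "\<i> \<in> gauss_int" "of_nat n \<in> gauss_int"
  "x \<in> gauss_int \<Longrightarrow> - x \<in> gauss_int" "numeral k \<in> gauss_int"
  by (auto simp: gauss_int_def)

lemma gauss_int_power: "x \<in> gauss_int \<Longrightarrow> x ^ n \<in> gauss_int"
  by (induction n) (auto intro: gauss_int_closed)

lemma gauss_int_sum: "(\<And>i. i \<in> A \<Longrightarrow> f i \<in> gauss_int) \<Longrightarrow> sum f A \<in> gauss_int"
  by (induction A rule: infinite_finite_induct) (auto intro: gauss_int_closed)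

lemma gauss_intE:
  assumes "z \<in> gauss_int"
  obtains a b :: int where "z = Complex (of_int a) (of_int b)"
  using assms by (metis (mono_tags, lifting) Ints_cases complex.collapse gauss_int_def mem_Collect_eq)

lemma norm_sq_Complex_int: "(norm (Complex (of_int a) (of_int b))) ^ 2 = of_int (a ^ 2 + b ^ 2)"
  by (simp add: cmod_power2)

text \<open>Squares are 0 or 1 modulo 3, so two of them cancel only if both vanish. This expresses
  that 3 is inert in the Gaussian integers.\<close>

lemma three_dvd_sum_squares:
  fixes a b :: int
  assumes "3 dvd a ^ 2 + b ^ 2"
  shows "3 dvd a \<and> 3 dvd b"
proof -
  have sq: "x ^ 2 mod 3 = (if 3 dvd x then 0 else 1)" for x :: int
  proof -
    have "x mod 3 = 0 \<or> x mod 3 = 1 \<or> x mod 3 = 2" by presburger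
    then have "(x mod 3) ^ 2 mod 3 = (if x mod 3 = 0 then 0 else 1)" by (elim disjE) simp_all
    then show ?thesis by (simp only: power_mod dvd_eq_mod_eq_0)
  qed
  have "(a ^ 2 mod 3 + b ^ 2 mod 3) mod 3 = 0" using assms by (simp add: mod_add_eq dvd_eq_mod_eq_0)
  then show ?thesis unfolding sq by (auto split: if_splits)
qed

lemma gauss_int_div_3:
  assumes "z \<in> gauss_int" "(norm z) ^ 2 = of_int (3 * m)"
  obtains y where "y \<in> gauss_int" "z = 3 * y"
proof -
  obtain a b :: int where z: "z = Complex (of_int a) (of_int b)" using gauss_intE[OF assms(1)] .
  have "a ^ 2 + b ^ 2 = 3 * m" using assms(2) unfolding z norm_sq_Complex_int by (simp only: of_int_eq_iff)
  then have "3 dvd a ^ 2 + b ^ 2" by simp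
  then obtain c d where "a = 3 * c" "b = 3 * d" using three_dvd_sum_squares by (meson dvdE)
  then have "z = 3 * Complex (of_int c) (of_int d)" by (simp add: z complex_eq_iff)
  moreover have "Complex (of_int c) (of_int d) \<in> gauss_int" by (simp add: gauss_int_def)
  ultimately show ?thesis using that by blast
qed

text \<open>Since 3 is inert, each factor 9 of the squared modulus splits off one factor 3, until an
  element of modulus 1 remains.\<close>

lemma gauss_int_norm_power_9:
  assumes "z \<in> gauss_int" "(norm z) ^ 2 = 9 ^ k"
  obtains u where "u \<in> gauss_int" "norm u = 1" "z = 3 ^ k * u"
  using assms
proof (induction k arbitrary: z thesis)
  case 0
  then show ?case by (metis mult_1 norm_ge_zero one_power2 power2_eq_iff_nonneg power_0 zero_le_one)
next
  case (Suc k)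
  have "(norm z) ^ 2 = of_int (3 * (3 * 9 ^ k))" using Suc.prems by simp
  then obtain y where y: "y \<in> gauss_int" "z = 3 * y" using gauss_int_div_3 Suc.prems by blast
  have "(norm y) ^ 2 = 9 ^ k" using Suc.prems(3) y by (simp add: norm_mult power_mult_distrib)
  then obtain u where "u \<in> gauss_int" "norm u = 1" "y = 3 ^ k * u" using Suc.IH y by blast
  then show ?case using Suc.prems(1)[of u] y by simp
qed

lemma gauss_int_norm_sq_int:
  assumes "z \<in> gauss_int"
  obtains n :: int where "(norm z) ^ 2 = of_int n"
  using gauss_intE[OF assms] norm_sq_Complex_int by metis

text \<open>Squared moduli give \<open>n ^ 3 = 9 * m\<close>, so 3 divides \<open>n\<close>, and
  inertness of 3 carries this back to \<open>z\<close>.\<close>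

lemma gauss_int_cube_div_3:
  assumes "z \<in> gauss_int" "y \<in> gauss_int" "z ^ 3 = 3 * y"
  obtains x where "x \<in> gauss_int" "z = 3 * x"
proof -
  obtain n m :: int where n: "(norm z) ^ 2 = of_int n" and m: "(norm y) ^ 2 = of_int m"
    using gauss_int_norm_sq_int assms by metis
  have "((norm z) ^ 2) ^ 3 = (norm (z ^ 3)) ^ 2" by (simp add: norm_power flip: power_mult)
  also have "\<dots> = 9 * (norm y) ^ 2" by (simp add: assms norm_mult power_mult_distrib)
  finally have "real_of_int (n ^ 3) = real_of_int (9 * m)" using n m by simp
  then have "n ^ 3 = 9 * m" by (simp only: of_int_eq_iff)
  then have "3 dvd n ^ 3" by simp
  then have "3 dvd n" using prime_dvd_power[of "3::int" n 3] by (simp)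
  then obtain k where "n = 3 * k" by (meson dvdE)
  then show ?thesis using gauss_int_div_3[of z k] assms(1) n that by auto
qed

text \<open>If \<open>3 ^ j\<close> divides \<open>B\<close> exactly and \<open>j < e\<close>, then \<open>B\<^sup>3\<close> is the unique term of least 3-adic valuation.\<close>

lemma gauss_int_cubic_dvd:
  assumes B: "B \<in> gauss_int" and u: "u \<in> gauss_int" and v: "v \<in> gauss_int"
    and eq: "B ^ 3 - 3 * (3 ^ (2 * e) * u) * B = 2 * (3 ^ (3 * e) * v)"
  obtains x where "x \<in> gauss_int" "B = 3 ^ e * x"
proof -
  have "j \<le> e \<Longrightarrow> \<exists>x\<in>gauss_int. B = 3 ^ j * x" for j
  proof (induction j)
    case (Suc j)
    then obtain x where x: "x \<in> gauss_int" "B = 3 ^ j * x" by auto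
    \<comment> \<open>With \<open>e = j + 1 + i\<close>, dividing the cubic equation by
      \<open>3 ^ (3 * j)\<close> leaves a factor 3 in both terms other than
      \<open>x ^ 3\<close>.\<close>
    obtain i where i: "e = Suc (j + i)" using Suc.prems by (metis Suc_le_D add_Suc less_iff_Suc_add Suc_le_eq)
    have "3 ^ (3 * j) * x ^ 3 = 3 ^ (3 * j) * (3 * (3 ^ (2 * Suc i) * u * x + 2 * 3 ^ (2 + 3 * i) * v))"
    proof -
      have "B ^ 3 = 3 * (3 ^ (2 * e) * u) * B + 2 * (3 ^ (3 * e) * v)" using eq by (simp add: algebra_simps)
      moreover have "2 * e + j = 3 * j + 2 * Suc i" "3 * e = 3 * j + Suc (2 + 3 * i)" using i by simp_all
      moreover have "3 * (3 ^ (2 * e) * u) * B = 3 * (3 ^ (2 * e + j) * u * x)" by (simp add: x power_add)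
      moreover have "B ^ 3 = 3 ^ (3 * j) * x ^ 3" by (simp add: x power_mult_distrib mult.commute flip: power_mult)
      ultimately show ?thesis by (simp only: power_add) (simp add: algebra_simps)
    qed
    then have "x ^ 3 = 3 * (3 ^ (2 * Suc i) * u * x + 2 * 3 ^ (2 + 3 * i) * v)" by simp
    moreover have "3 ^ (2 * Suc i) * u * x + 2 * 3 ^ (2 + 3 * i) * v \<in> gauss_int"
      by (intro gauss_int_closed gauss_int_power u v x)
    ultimately obtain y where "y \<in> gauss_int" "x = 3 * y" using gauss_int_cube_div_3[OF x(1)] by blast
    then have "B = 3 ^ Suc j * y" using x by simp
    then show ?case using \<open>y \<in> gauss_int\<close> by blast
  qed (use B in auto)
  then show ?thesis using that by blast
qed

text \<open>Among the Gaussian integers of modulus at most 2, oddness of \<open>Re x + Im x\<close>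
  excludes 0, the four of modulus 2 and the four of squared modulus 2.\<close>

lemma odd_gauss_int_small_unit:
  assumes "x \<in> gauss_int" "norm x \<le> 2" "Re x + Im x = of_int k" "odd k"
  shows "x \<in> {1, -1, \<i>, -\<i>}"
proof -
  obtain a b :: int where x: "x = Complex (of_int a) (of_int b)" using gauss_intE[OF assms(1)] .
  have "real_of_int (a + b) = of_int k" using assms(3) by (simp add: x)
  then have "a + b = k" by (simp only: of_int_eq_iff)
  with assms(4) have "odd (a + b)" by simp
  have "(norm x) ^ 2 \<le> 2 ^ 2" using assms(2) by (intro power_mono) auto
  then have "real_of_int (a ^ 2 + b ^ 2) \<le> of_int 4" unfolding x norm_sq_Complex_int by simp
  then have le: "a ^ 2 + b ^ 2 \<le> 4" by (simp only: of_int_le_iff)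
  have "a ^ 2 \<le> 4" "b ^ 2 \<le> 4" using le zero_le_power2[of a] zero_le_power2[of b] by linarith+
  moreover have "(4::int) = 2 ^ 2" by simp
  ultimately have "a ^ 2 \<le> 2 ^ 2" "b ^ 2 \<le> 2 ^ 2" by (simp_all only:)
  then have "\<bar>a\<bar> \<le> \<bar>2\<bar>" "\<bar>b\<bar> \<le> \<bar>2\<bar>" by (simp_all only: abs_le_square_iff)
  then have "a \<in> {-2, -1, 0, 1, 2}" "b \<in> {-2, -1, 0, 1, 2}" by auto
  then have "(a, b) \<in> {(1, 0), (-1, 0), (0, 1), (0, -1)}"
    using le \<open>odd (a + b)\<close> by auto
  then show ?thesis by (auto simp: x complex_eq_iff)
qed

lemma gauss_int_cubic_unit:
  assumes B: "B \<in> gauss_int" and u: "u \<in> gauss_int" "norm u = 1" and v: "v \<in> gauss_int" "norm v = 1"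
    and eq: "B ^ 3 - 3 * (3 ^ (2 * e) * u) * B = 2 * (3 ^ (3 * e) * v)"
    and odd: "Re B + Im B = of_int k" "odd k"
  obtains x where "x \<in> {1, -1, \<i>, -\<i>}" "B = 3 ^ e * x"
proof -
  obtain x where x: "x \<in> gauss_int" "B = 3 ^ e * x" using gauss_int_cubic_dvd[OF B u(1) v(1) eq] .
  have "3 ^ (3 * e) * (x ^ 3 - 3 * u * x) = 3 ^ (3 * e) * (2 * v)"
  proof -
    have "(3::complex) ^ (3 * e) = 3 ^ (2 * e) * 3 ^ e" by (simp flip: power_add)
    moreover have "((3::complex) ^ e) ^ 3 = 3 ^ (2 * e) * 3 ^ e" by (simp add: mult.commute flip: power_mult power_add)
    ultimately show ?thesis using eq unfolding x(2) power_mult_distrib by (simp add: algebra_simps)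
  qed
  then have "x ^ 3 - 3 * u * x = 2 * v" by simp
  then have x3: "x ^ 3 = 2 * v + 3 * u * x" by (simp add: algebra_simps)
  let ?n = "norm x"
  have "?n ^ 3 \<le> 2 + 3 * ?n"
    using norm_triangle_ineq[of "2 * v" "3 * u * x"] u v by (simp add: norm_mult flip: x3) (simp add: norm_power)
  \<comment> \<open>For \<open>n = norm x\<close> the bound factors as
    \<open>n ^ 3 - 3 * n - 2 = (n - 2) * (n + 1) ^ 2\<close>, which gives
    \<open>n \<le> 2\<close>.\<close>
  then have "(?n - 2) * (?n + 1) ^ 2 \<le> 0" by (simp add: algebra_simps power2_eq_square power3_eq_cube)
  moreover have "(?n + 1) ^ 2 > 0" by (intro zero_less_power add_nonneg_pos) auto
  ultimately have n2: "?n \<le> 2" by (simp add: mult_le_0_iff)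
  obtain a b :: int where ab: "x = Complex (of_int a) (of_int b)" using gauss_intE[OF x(1)] .
  have B: "B = Complex (of_int (3 ^ e * a)) (of_int (3 ^ e * b))"
    using x(2) by (simp add: ab complex_eq_iff Re_power_real)
  have "real_of_int (3 ^ e * (a + b)) = of_int k" using odd(1) by (simp add: B algebra_simps)
  then have "3 ^ e * (a + b) = k" by (simp only: of_int_eq_iff)
  then have "odd (a + b)" using odd(2) by auto
  then have "x \<in> {1, -1, \<i>, -\<i>}"
    using odd_gauss_int_small_unit[OF x(1) n2, of "a + b"] by (simp add: ab)
  then show ?thesis using that x(2) by blast
qed

lemma gauss_int_unit:
  assumes "x \<in> gauss_int" "norm x = 1"
  shows "x \<in> {1, -1, \<i>, -\<i>}"
proof -
  obtain a b :: int where x: "x = Complex (of_int a) (of_int b)" using gauss_intE[OF assms(1)] .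
  have "real_of_int (a ^ 2 + b ^ 2) = of_int 1" using assms(2) norm_sq_Complex_int[of a b] x by simp
  then have ab: "a ^ 2 + b ^ 2 = 1" by (simp only: of_int_eq_iff)
  have "odd (a + b)"
  proof
    assume "even (a + b)"
    then have "even (a ^ 2 + b ^ 2)" by simp
    then show False by (simp add: ab)
  qed
  then show ?thesis using odd_gauss_int_small_unit[OF assms(1), of "a + b"] assms(2) by (simp add: x)
qed

text \<open>The functional \<open>Re + Im\<close> is 1 on \<open>1\<close> and \<open>\<i>\<close>
  and -1 on their negatives. It turns character sums into differences of point counts.\<close>

lemma Re_Im_unit_mult:
  assumes "x \<in> {1, -1, \<i>, -\<i>}"
  shows "Re (of_nat n * x) + Im (of_nat n * x) = real n \<or> Re (of_nat n * x) + Im (of_nat n * x) = - real n"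
  using assms by auto

section \<open>The quartic character and the trace of a cubic extension\<close>

text \<open>The exponent is the discrete logarithm to base \<open>w\<close>. Only its residue modulo
  4 matters, so the choice made by \<open>SOME\<close> is harmless once 4 divides the order of
  \<open>w\<close>.\<close>

definition quartic_char :: "'a::field \<Rightarrow> 'a \<Rightarrow> complex" where
  "quartic_char w x = (if x = 0 then 0 else \<i> ^ (SOME k. w ^ k = x))"

text \<open>Here \<open>q\<close> is any number congruent to 1 modulo 4 whose power map is additive;
  that it is a power of 3 enters with \<open>ternary_cubic_extension\<close>.\<close>

locale cubic_extension =
  fixes F :: "'a::{field,finite} set" and q N :: nat and \<omega> :: 'a
  assumes subfield: "is_subfield F" and card_F: "card F = q" and card_E: "CARD('a) = q ^ 3"
    and N_def: "N = q ^ 2 + q + 1"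
    and primitive: "primitive_element \<omega>" and q_mod_4: "q mod 4 = 1" and q_gt_1: "q > 1"
    and frob_add: "\<And>x y :: 'a. (x + y) ^ q = x ^ q + y ^ q"
begin

definition \<chi> :: "'a \<Rightarrow> complex" where "\<chi> = quartic_char \<omega>"

text \<open>Iterated \<open>q\<close>-th powers, rather than the exponent \<open>q ^ 2\<close>, let
  \<open>frob_cubed\<close> rewrite the conjugates cyclically.\<close>

definition tr :: "'a \<Rightarrow> 'a" where "tr x = x + x ^ q + (x ^ q) ^ q"

lemma F_closed [simp]:
  "0 \<in> F" "1 \<in> F" "x \<in> F \<Longrightarrow> y \<in> F \<Longrightarrow> x + y \<in> F" "x \<in> F \<Longrightarrow> y \<in> F \<Longrightarrow> x * y \<in> F"
  "x \<in> F \<Longrightarrow> - x \<in> F" "x \<in> F \<Longrightarrow> inverse x \<in> F"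
  using subfield by (auto simp: is_subfield_def)

lemma F_closed' [simp]:
  "x \<in> F \<Longrightarrow> y \<in> F \<Longrightarrow> x - y \<in> F" "x \<in> F \<Longrightarrow> y \<in> F \<Longrightarrow> x / y \<in> F" "x \<in> F \<Longrightarrow> x ^ n \<in> F"
  using F_closed(3)[of x "- y"] F_closed(4)[of x "inverse y"]
  by (auto simp: divide_inverse intro: F_closed(5,6)) (induction n; simp)

lemma order_factor: "q ^ 3 - 1 = (q - 1) * N"
proof -
  obtain p where "q = Suc p" using q_gt_1 by (cases q) auto
  then show ?thesis by (simp add: N_def power3_eq_cube power2_eq_square algebra_simps)
qed

lemma omega_order: "has_mult_order \<omega> (q ^ 3 - 1)"
  using primitive_element_order[OF primitive] card_E by simp

lemma omega_nonzero [simp]: "\<omega> \<noteq> 0"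
  using primitive unfolding primitive_element_def by (metis Diff_iff insertI1 power_one_right rangeI)

lemma omega_power: obtains k :: nat where "x = 0 \<or> x = \<omega> ^ k"
  using primitive unfolding primitive_element_def by (metis DiffI UNIV_I empty_iff insert_iff rangeE)

lemma power_order: "x \<noteq> 0 \<Longrightarrow> x ^ (q ^ 3 - 1) = 1" for x :: 'a
  using omega_power[of x] has_mult_order_power_eq_1_iff[OF omega_order]
  by (metis dvd_triv_right power_mult)

lemma four_dvd: "4 dvd q - 1"
  using q_mod_4 q_gt_1 by (metis dvd_minus_mod)

lemma four_dvd_order: "4 dvd q ^ 3 - 1"
  using four_dvd unfolding order_factor by (rule dvd_mult2)

lemma i_power_4: "\<i> ^ 4 = 1"
  by (simp add: numeral_eq_Suc)

lemma i_power_dvd: "4 dvd n \<Longrightarrow> \<i> ^ n = 1"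
  by (auto simp: power_mult i_power_4)

lemma chi_0 [simp]: "\<chi> 0 = 0" by (simp add: \<chi>_def quartic_char_def)

text \<open>Exponents giving the same power of \<open>\<omega>\<close> differ by a multiple of
  \<open>q ^ 3 - 1\<close>, which 4 divides, so they give the same power of
  \<open>\<i>\<close>.\<close>

lemma chi_omega_power: "\<chi> (\<omega> ^ k) = \<i> ^ k"
proof -
  have wd: "\<i> ^ i = \<i> ^ j" if "\<omega> ^ i = \<omega> ^ j" "i \<le> j" for i j
  proof -
    have "\<omega> ^ (j - i) = 1" using that by (simp add: power_diff)
    then have "4 dvd j - i" using four_dvd_order has_mult_order_power_eq_1_iff[OF omega_order]
      by (meson dvd_trans)
    then have "\<i> ^ (j - i + i) = \<i> ^ i" by (simp only: power_add i_power_dvd mult_1)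
    then show ?thesis using that by simp
  qed
  have "\<omega> ^ (SOME j. \<omega> ^ j = \<omega> ^ k) = \<omega> ^ k" by (rule someI) simp
  then show ?thesis unfolding \<chi>_def quartic_char_def
    using wd[of k] wd[of _ k] by (metis nle_le omega_nonzero power_not_zero)
qed

lemma chi_1 [simp]: "\<chi> 1 = 1" using chi_omega_power[of 0] by simp

lemma chi_mult: "\<chi> (x * y) = \<chi> x * \<chi> y"
proof -
  obtain j k where "x = 0 \<or> x = \<omega> ^ j" "y = 0 \<or> y = \<omega> ^ k" by (metis omega_power)
  then show ?thesis by (auto simp: chi_omega_power simp flip: power_add)
qed

lemma chi_power: "\<chi> (x ^ n) = \<chi> x ^ n" by (induction n) (auto simp: chi_mult)

lemma chi_power_4: "x \<noteq> 0 \<Longrightarrow> \<chi> x ^ 4 = 1"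
  using omega_power[of x] by (metis chi_omega_power i_power_dvd dvd_triv_right power_mult)

lemma chi_eq_0_iff [simp]: "\<chi> x = 0 \<longleftrightarrow> x = 0"
  using chi_power_4[of x] by (cases "x = 0") auto

lemma norm_chi: "x \<noteq> 0 \<Longrightarrow> norm (\<chi> x) = 1"
  using omega_power[of x] chi_omega_power by (metis norm_ii norm_power power_one)

lemma chi_cnj: "x \<noteq> 0 \<Longrightarrow> \<chi> x * cnj (\<chi> x) = 1"
  using norm_chi[of x] by (simp add: complex_norm_square[symmetric])

lemma chi_cases: "x \<noteq> 0 \<Longrightarrow> \<chi> x \<in> {1, \<i>, -1, -\<i>}"
proof -
  assume "x \<noteq> 0"
  then have "(\<chi> x - 1) * (\<chi> x - \<i>) * (\<chi> x + 1) * (\<chi> x + \<i>) = 0"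
    using chi_power_4[of x] by (simp add: algebra_simps numeral_eq_Suc)
  then show ?thesis by (auto simp: eq_neg_iff_add_eq_0)
qed

text \<open>Fourth powers of nonzero character values are 1 and \<open>q\<close> is 1 modulo 4, so
  conjugate elements have the same character value.\<close>

lemma chi_frob: "\<chi> (x ^ q) = \<chi> x"
proof (cases "x = 0")
  case False
  obtain m where m: "q = 4 * m + 1" using q_mod_4 by (metis div_mult_mod_eq mult.commute)
  show ?thesis using chi_power_4[OF False] unfolding chi_power m by (simp add: power_add power_mult)
qed (use q_gt_1 in simp)

lemma chi_inverse: "\<chi> (inverse x) = cnj (\<chi> x)"
proof (cases "x = 0")
  case False
  then have "\<chi> (inverse x) * (\<chi> x * cnj (\<chi> x)) = cnj (\<chi> x)"
    by (metis chi_1 chi_mult left_inverse mult.assoc mult_1)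
  then show ?thesis using chi_cnj[OF False] by simp
qed simp

section \<open>The subfield as the fixed field of the Frobenius map\<close>

lemma frob_fixed_omega_power:
  assumes "x ^ q = x" "x \<noteq> 0"
  obtains j where "j < q - 1" "x = (\<omega> ^ N) ^ j"
proof -
  have "x ^ (q - 1) = 1" using assms q_gt_1 by (simp add: power_diff)
  moreover obtain k where k: "x = \<omega> ^ k" using omega_power[of x] assms(2) by auto
  ultimately have "(q - 1) * N dvd k * (q - 1)"
    using has_mult_order_power_eq_1_iff[OF omega_order] unfolding order_factor k
    by (metis power_mult)
  then have "(q - 1) * N dvd (q - 1) * k" by (simp only: mult.commute)
  then have "N dvd k" using q_gt_1 by (metis nat_mult_dvd_cancel1 zero_less_diff)
  then obtain j where j: "k = N * j" by auto
  have w: "(\<omega> ^ N) ^ (q - 1) = 1" using power_order[of \<omega>] unfolding order_factor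
    by (metis mult.commute omega_nonzero power_mult)
  have "x = (\<omega> ^ N) ^ ((q - 1) * (j div (q - 1)) + j mod (q - 1))" by (simp add: k j power_mult)
  also have "\<dots> = (\<omega> ^ N) ^ (j mod (q - 1))" by (simp only: power_add power_mult w power_one mult_1)
  finally show ?thesis using that[of "j mod (q - 1)"] q_gt_1 by simp
qed

text \<open>Multiplication by a nonzero \<open>x\<close> of \<open>F\<close> permutes
  \<open>F - {0}\<close>, which gives \<open>x ^ (q - 1) = 1\<close>. Conversely, 0 and the powers
  of \<open>\<omega> ^ N\<close> provide at most \<open>q\<close> fixed elements, so
  \<open>F\<close> contains all of them.\<close>

lemma power_q_eq_iff: "x ^ q = x \<longleftrightarrow> x \<in> F"
proof -
  have F_fix: "x ^ q = x" if "x \<in> F" for x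
  proof (cases "x = 0")
    case False
    have "prod (\<lambda>y. y) (F - {0}) = (\<Prod>y\<in>F - {0}. x * y)"
    proof (rule prod.reindex_bij_witness[of _ "\<lambda>y. x * y" "\<lambda>y. inverse x * y"])
    qed (use that False in \<open>auto simp: field_simps\<close>)
    also have "\<dots> = x ^ card (F - {0}) * prod (\<lambda>y. y) (F - {0})"
      by (simp add: prod.distrib)
    finally have "x ^ card (F - {0}) = 1" by simp
    then have "x ^ (q - 1) = 1" by (simp add: card_F card_Diff_subset)
    then have "x ^ Suc (q - 1) = x" by simp
    then show ?thesis using q_gt_1 by simp
  qed (use q_gt_1 in simp)
  let ?A = "insert 0 ((\<lambda>j. (\<omega> ^ N) ^ j) ` {..<q - 1})"
  have "{x :: 'a. x ^ q = x} \<subseteq> ?A"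
    using frob_fixed_omega_power by blast
  then have "card {x :: 'a. x ^ q = x} \<le> card ?A" by (intro card_mono) auto
  also have "\<dots> \<le> Suc (card ((\<lambda>j. (\<omega> ^ N) ^ j) ` {..<q - 1}))" by (simp add: card_insert_if)
  also have "\<dots> \<le> q" using card_image_le[of "{..<q - 1}" "\<lambda>j. (\<omega> ^ N) ^ j"] q_gt_1 by simp
  finally have "F = {x. x ^ q = x}"
    using F_fix card_F by (intro card_seteq) auto
  then show ?thesis by auto
qed

lemma F_fixed [simp]: "x \<in> F \<Longrightarrow> x ^ q = x"
  by (simp add: power_q_eq_iff)

lemma frob_mult: "(x * y :: 'a) ^ q = x ^ q * y ^ q" by (rule power_mult_distrib)

lemma frob_minus: "(- x :: 'a) ^ q = - (x ^ q)"
  using frob_add[of "-x" x] q_gt_1 by (simp add: eq_neg_iff_add_eq_0)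

lemma frob_diff: "(x - y :: 'a) ^ q = x ^ q - y ^ q"
  using frob_add[of x "-y"] by (simp add: frob_minus)

lemma frob_cubed [simp]: "((x ^ q) ^ q) ^ q = (x :: 'a)"
proof (cases "x = 0")
  case False
  have "((x ^ q) ^ q) ^ q = x ^ Suc (q ^ 3 - 1)"
    using q_gt_1 by (simp add: power_mult[symmetric] power3_eq_cube del: power_Suc)
  also have "\<dots> = x" using power_order[OF False] by simp
  finally show ?thesis .
qed (use q_gt_1 in simp)

lemma frob_eq_iff: "x ^ q = y ^ q \<longleftrightarrow> x = (y :: 'a)"
  by (metis frob_cubed)

section \<open>The trace form\<close>

lemma tr_in_F [simp]: "tr x \<in> F"
  by (simp add: tr_def frob_add algebra_simps flip: power_q_eq_iff)

lemma tr_add: "tr (x + y) = tr x + tr y"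
  by (simp add: tr_def frob_add algebra_simps)

lemma tr_scale: "c \<in> F \<Longrightarrow> tr (c * x) = c * tr x"
  by (simp add: tr_def frob_mult algebra_simps)

lemma tr_0 [simp]: "tr 0 = 0" using q_gt_1 by (simp add: tr_def)

lemma tr_diff: "tr (x - y) = tr x - tr y"
  by (simp add: tr_def frob_diff)

text \<open>The trace is a nonzero polynomial function of degree at most \<open>q ^ 2\<close>, too
  small to vanish on all \<open>q ^ 3\<close> elements.\<close>

lemma tr_nonzero: "\<exists>x. tr x \<noteq> 0"
proof (rule ccontr)
  assume "\<not> ?thesis"
  then have all: "tr x = 0" for x by auto
  define p :: "'a poly" where "p = monom 1 1 + monom 1 q + monom 1 (q * q)"
  have p: "poly p x = tr x" for x by (simp add: p_def poly_monom tr_def power_mult)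
  have "coeff p 1 = 1" using q_gt_1 by (simp add: p_def)
  then have "p \<noteq> 0" by auto
  have "degree p \<le> q * q" unfolding p_def
    using q_gt_1 by (intro degree_add_le) (auto intro: order.trans[OF degree_monom_le])
  moreover have "card {x. poly p x = 0} \<le> degree p"
    using \<open>p \<noteq> 0\<close> by (rule card_poly_roots_bound)
  moreover have "{x. poly p x = 0} = UNIV" using all p by auto
  ultimately have "q ^ 3 \<le> q * q" using card_E by simp
  then have "q * q * q \<le> q * q" by (simp only: power3_eq_cube)
  moreover have "q * q * 1 < q * q * q" using q_gt_1 by (intro mult_strict_left_mono) auto
  ultimately show False by linarith
qed

lemma tr_nondegenerate:
  assumes "\<And>x. tr (u * x) = 0"
  shows "u = 0"
proof (rule ccontr)
  assume "u \<noteq> 0"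
  obtain x where "tr x \<noteq> 0" using tr_nonzero by blast
  then show False using assms[of "x / u"] \<open>u \<noteq> 0\<close> by simp
qed

lemma tr_1_ex: obtains x where "tr x = 1"
proof -
  obtain x where "tr x \<noteq> 0" using tr_nonzero by blast
  then have "tr (inverse (tr x) * x) = 1" by (simp add: tr_scale)
  then show ?thesis using that by blast
qed

lemma card_tr_fibre:
  assumes "u \<noteq> 0" "\<alpha> \<in> F"
  shows "card {x. tr (u * x) = \<alpha>} = q ^ 2"
proof -
  obtain x1 where x1: "tr x1 = 1" using tr_1_ex by blast
  have "range (\<lambda>x. tr (u * x)) = F"
  proof
    show "F \<subseteq> range (\<lambda>x. tr (u * x))"
    proof
      fix c assume "c \<in> F"
      then have "tr (u * (c * x1 / u)) = c" using assms x1 by (simp add: tr_scale)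
      then show "c \<in> range (\<lambda>x. tr (u * x))" by (metis rangeI)
    qed
  qed auto
  then have "card {x. tr (u * x) = \<alpha>} * card F = CARD('a)"
    by (rule card_additive_fibre[rotated]) (auto simp: assms tr_add distrib_left)
  then show ?thesis using q_gt_1 by (simp add: card_E card_F power3_eq_cube power2_eq_square)
qed

text \<open>Two trace functionals whose multipliers are independent over \<open>F\<close> map
  jointly onto \<open>F \<times> F\<close>, so each fibre has \<open>q ^ 3 / q ^ 2\<close>
  elements.\<close>

lemma card_tr_fibre2:
  assumes "v \<noteq> 0" "\<not> (\<exists>c\<in>F. u = c * v)" "\<alpha> \<in> F" "\<beta> \<in> F"
  shows "card {x. tr (v * x) = \<alpha> \<and> tr (u * x) = \<beta>} = q"
proof -
  obtain y where y: "tr y = 1" using tr_1_ex by blast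
  define x1 where "x1 = y / v"
  have x1: "tr (v * x1) = 1" using y assms(1) by (simp add: x1_def)
  obtain w where w: "tr (v * w) = 0" "tr (u * w) \<noteq> 0"
  proof (rule ccontr)
    assume "\<not> thesis"
    then have *: "tr (v * w) = 0 \<Longrightarrow> tr (u * w) = 0" for w using that by blast
    \<comment> \<open>If the kernel of the functional of \<open>v\<close> lay in that of
      \<open>u\<close>, the two would be proportional, and \<open>x1\<close>, where the first takes
      the value 1, fixes the factor.\<close>
    define c where "c = tr (u * x1)"
    have "tr ((u - c * v) * x) = 0" for x
    proof -
      define b where "b = tr (v * x)"
      have b: "b \<in> F" and c: "c \<in> F" by (simp_all add: b_def c_def)
      have eq: "tr (z * (x - b * x1)) = tr (z * x) - b * tr (z * x1)" for z
        using b tr_diff[of "z * x" "b * (z * x1)"] tr_scale[of b "z * x1"] by (simp add: algebra_simps)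
      have "tr (v * (x - b * x1)) = 0" using x1 by (simp add: eq) (simp add: b_def)
      then have "tr (u * (x - b * x1)) = 0" by (rule *)
      then have "tr (u * x) = b * c" by (simp add: eq c_def)
      moreover have "tr ((u - c * v) * x) = tr (u * x) - c * b"
        using c tr_diff[of "u * x" "c * (v * x)"] tr_scale[of c "v * x"] by (simp add: algebra_simps b_def)
      ultimately show ?thesis by simp
    qed
    from tr_nondegenerate[OF this] have "u = c * v" by simp
    then show False using assms(2) c_def by auto
  qed
  let ?f = "\<lambda>x. (tr (v * x), tr (u * x))"
  have "range ?f = F \<times> F"
  proof
    show "F \<times> F \<subseteq> range ?f"
    proof clarify
      fix a b assume ab: "a \<in> F" "b \<in> F"
      define d where "d = (b - a * tr (u * x1)) / tr (u * w)"
      have d: "d \<in> F" using ab by (simp add: d_def)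
      have eq: "tr (z * (a * x1 + d * w)) = a * tr (z * x1) + d * tr (z * w)" for z
        using ab d tr_add[of "a * (z * x1)" "d * (z * w)"] tr_scale[of a "z * x1"] tr_scale[of d "z * w"]
        by (simp add: algebra_simps)
      have "?f (a * x1 + d * w) = (a, b)"
        using x1 w by (simp add: eq) (simp add: d_def)
      then show "(a, b) \<in> range ?f" by (intro range_eqI[of _ _ "a * x1 + d * w"]) simp
    qed
  qed auto
  then have "card {x. ?f x = (\<alpha>, \<beta>)} * card (F \<times> F) = CARD('a)"
    by (rule card_additive_fibre[rotated]) (auto simp: assms tr_add distrib_left)
  then show ?thesis using q_gt_1 by (simp add: card_E card_F power3_eq_cube card_cartesian_product)
qed

section \<open>Character sums over planes\<close>

lemma omega_N_in_F: "\<omega> ^ N \<in> F"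
proof -
  have "(\<omega> ^ N) ^ (q - 1) = 1" using power_order[of \<omega>] unfolding order_factor
    by (metis mult.commute omega_nonzero power_mult)
  then have "(\<omega> ^ N) ^ Suc (q - 1) = \<omega> ^ N" by simp
  then show ?thesis using q_gt_1 by (simp flip: power_q_eq_iff)
qed

text \<open>\<open>N\<close> is 3 modulo 4. Hence \<open>\<chi>\<close> sends the generator
  \<open>\<omega> ^ N\<close> of the nonzero elements of \<open>F\<close> to \<open>- \<i>\<close>
  and is still of order 4 on \<open>F\<close>.\<close>

lemma i_power_N: "\<i> ^ N = - \<i>"
proof -
  obtain m where m: "q = 4 * m + 1" using q_mod_4 by (metis div_mult_mod_eq mult.commute)
  have "N = 4 * (4 * m * m + 3 * m) + 3" by (simp add: N_def m power2_eq_square algebra_simps)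
  then have "\<i> ^ N = \<i> ^ (4 * (4 * m * m + 3 * m)) * \<i> ^ 3" by (simp only: power_add)
  also have "\<dots> = - \<i>" by (simp add: i_power_dvd) (simp add: numeral_eq_Suc)
  finally show ?thesis .
qed

lemma sum_chi_F: "(\<Sum>c\<in>F. \<chi> c) = 0"
proof -
  let ?w = "\<omega> ^ N"
  have "(\<Sum>c\<in>F. \<chi> c) = (\<Sum>c\<in>F. \<chi> (?w * c))"
    by (rule sum.reindex_bij_witness[of _ "\<lambda>y. ?w * y" "\<lambda>y. y / ?w"])
      (use omega_N_in_F in auto)
  also have "\<dots> = \<chi> ?w * (\<Sum>c\<in>F. \<chi> c)" by (simp add: chi_mult sum_distrib_left)
  finally have "(\<Sum>c\<in>F. \<chi> c) = 0 \<or> \<chi> ?w = 1" by (simp only: mult_cancel_right1)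
  moreover have "\<chi> ?w \<noteq> 1" by (simp add: chi_omega_power i_power_N complex_eq_iff)
  ultimately show ?thesis by blast
qed

lemma sum_chi_power:
  assumes "\<not> 4 dvd k"
  shows "(\<Sum>x\<in>UNIV. \<chi> x ^ k) = 0"
proof -
  have "(\<Sum>x\<in>UNIV. \<chi> x ^ k) = (\<Sum>x\<in>UNIV. \<chi> (\<omega> * x) ^ k)"
    by (rule sum.reindex_bij_witness[of _ "\<lambda>y. \<omega> * y" "\<lambda>y. y / \<omega>"]) auto
  also have "\<dots> = \<chi> \<omega> ^ k * (\<Sum>x\<in>UNIV. \<chi> x ^ k)"
    by (simp add: chi_mult sum_distrib_left power_mult_distrib)
  finally have "(\<Sum>x\<in>UNIV. \<chi> x ^ k) = 0 \<or> \<chi> \<omega> ^ k = 1" by (simp only: mult_cancel_right1)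
  moreover have "\<chi> \<omega> = \<i>" using chi_omega_power[of 1] by simp
  ultimately have *: "(\<Sum>x\<in>UNIV. \<chi> x ^ k) = 0 \<or> \<i> ^ k = 1" by simp
  have "\<i> ^ k \<noteq> 1"
  proof -
    have "k = 4 * (k div 4) + k mod 4" by simp
    then have "\<i> ^ k = \<i> ^ (4 * (k div 4)) * \<i> ^ (k mod 4)" by (metis power_add)
    then have eq: "\<i> ^ k = \<i> ^ (k mod 4)" by (simp add: i_power_dvd)
    have "k mod 4 = 1 \<or> k mod 4 = 2 \<or> k mod 4 = 3" using assms by presburger
    then show ?thesis unfolding eq by (elim disjE) (simp_all add: power3_eq_cube complex_eq_iff)
  qed
  then show ?thesis using * by simp
qed

lemma sum_chi: "(\<Sum>x\<in>UNIV. \<chi> x) = 0"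
  using sum_chi_power[of 1] by simp

section \<open>Planes off the origin\<close>

definition plane_sum :: "'a \<Rightarrow> complex" where
  "plane_sum u = (\<Sum>x | tr (u * x) = 1. \<chi> x)"

lemma plane_sum_conj:
  assumes "u \<noteq> 0"
  shows "plane_sum u = cnj (\<chi> u) * plane_sum 1"
proof -
  have "plane_sum u = (\<Sum>x | tr x = 1. \<chi> (x / u))"
    unfolding plane_sum_def
    by (rule sum.reindex_bij_witness[of _ "\<lambda>x. x / u" "\<lambda>x. u * x"]) (use assms in auto)
  then show ?thesis by (simp add: plane_sum_def divide_inverse chi_mult chi_inverse sum_distrib_left mult.commute)
qed

text \<open>The sum over the line spanned by \<open>x\<close> is a multiple of the sum over
  \<open>F\<close>, which is 0, and the sum over the whole field is 0 as well.\<close>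

lemma sum_chi_off_line:
  assumes "x \<noteq> 0"
  shows "(\<Sum>y | \<not> (\<exists>c\<in>F. y = c * x). \<chi> y) = 0"
proof -
  have "(\<Sum>y | \<exists>c\<in>F. y = c * x. \<chi> y) = (\<Sum>c\<in>F. \<chi> (c * x))"
    by (rule sum.reindex_bij_witness[of _ "\<lambda>c. c * x" "\<lambda>y. y / x"]) (use assms in auto)
  also have "\<dots> = 0" by (simp add: chi_mult sum_chi_F flip: sum_distrib_right)
  finally have "(\<Sum>y | \<exists>c\<in>F. y = c * x. \<chi> y) = 0" .
  moreover have "(\<Sum>y\<in>UNIV. \<chi> y) = (\<Sum>y | \<exists>c\<in>F. y = c * x. \<chi> y) + (\<Sum>y | \<not> (\<exists>c\<in>F. y = c * x). \<chi> y)"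
    by (subst sum.union_disjoint[symmetric]) (auto intro!: sum.cong)
  ultimately show ?thesis by (simp add: sum_chi)
qed

text \<open>Distinct proportional points lie on no common plane, because
  \<open>tr (u * y) = c * tr (u * x)\<close> with \<open>c\<close> different from 1. Otherwise the
  count is a fibre of one trace functional or of two independent ones.\<close>

lemma card_common_planes:
  assumes "x \<noteq> 0" "y \<noteq> 0"
  shows "card {u. tr (u * x) = 1 \<and> tr (u * y) = 1} =
    (if y = x then q ^ 2 else if \<exists>c\<in>F. y = c * x then 0 else q)"
proof -
  have "{u. tr (u * x) = 1 \<and> tr (u * y) = 1} = {}" if "c \<in> F" "y = c * x" "y \<noteq> x" for c
  proof -
    have "tr (u * y) = c * tr (u * x)" for u
      using that tr_scale[of c "u * x"] by (simp add: algebra_simps)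
    moreover have "c \<noteq> 1" using that by auto
    ultimately show ?thesis by auto
  qed
  then show ?thesis
    using card_tr_fibre[of x 1] card_tr_fibre2[of x y 1 1] assms
    by (auto simp: mult.commute)
qed

text \<open>All planes off the origin have sums of the same modulus, so the second moment, computed by double
  counting pairs of points, determines it.\<close>

lemma norm_plane_sum_1: "norm (plane_sum 1) = q"
proof -
  let ?P = "plane_sum 1" and ?U = "UNIV - {0::'a}"
  have sq: "plane_sum u * cnj (plane_sum u) = ?P * cnj ?P" if "u \<noteq> 0" for u
  proof -
    have "plane_sum u * cnj (plane_sum u) = (\<chi> u * cnj (\<chi> u)) * (?P * cnj ?P)"
      by (simp add: plane_sum_conj[OF that])
    then show ?thesis using chi_cnj[OF that] by simp
  qed
  have p: "plane_sum u = (\<Sum>x\<in>?U. if tr (u * x) = 1 then \<chi> x else 0)" for u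
    unfolding plane_sum_def by (rule sum.mono_neutral_cong_left) auto
  have "of_nat (q ^ 3 - 1) * (?P * cnj ?P) = (\<Sum>u\<in>?U. plane_sum u * cnj (plane_sum u))"
  proof -
    have "(\<Sum>u\<in>?U. plane_sum u * cnj (plane_sum u)) = (\<Sum>u\<in>?U. ?P * cnj ?P)"
      by (rule sum.cong[OF refl], rule sq) simp
    then show ?thesis by (simp add: card_Diff_subset card_E)
  qed
  also have "\<dots> = (\<Sum>u\<in>UNIV. plane_sum u * cnj (plane_sum u))"
    by (rule sum.mono_neutral_left) (auto simp: plane_sum_def)
  also have "\<dots> = (\<Sum>u\<in>UNIV. \<Sum>x\<in>?U. \<Sum>y\<in>?U. if tr (u * x) = 1 \<and> tr (u * y) = 1 then \<chi> x * cnj (\<chi> y) else 0)"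
    unfolding p cnj_sum sum_product by (intro sum.cong refl) simp
  also have "\<dots> = (\<Sum>x\<in>?U. \<Sum>y\<in>?U. \<Sum>u\<in>UNIV. if tr (u * x) = 1 \<and> tr (u * y) = 1 then \<chi> x * cnj (\<chi> y) else 0)"
    by (subst sum.swap, rule sum.cong, rule refl, rule sum.swap)
  also have "\<dots> = (\<Sum>x\<in>?U. of_nat (q ^ 2))"
  proof (rule sum.cong[OF refl])
    fix x assume "x \<in> ?U"
    then have x: "x \<noteq> 0" by simp
    let ?D = "{y. \<not> (\<exists>c\<in>F. y = c * x)}"
    have "(\<Sum>y\<in>?U. \<Sum>u\<in>UNIV. if tr (u * x) = 1 \<and> tr (u * y) = 1 then \<chi> x * cnj (\<chi> y) else 0)
      = (\<Sum>y\<in>?U. of_nat (card {u. tr (u * x) = 1 \<and> tr (u * y) = 1}) * (\<chi> x * cnj (\<chi> y)))"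
      by (simp add: sum.If_cases Int_def)
    \<comment> \<open>The diagonal \<open>y = x\<close> and the points off the line spanned by
      \<open>x\<close> are the only contributions; the latter cancel by
      \<open>sum_chi_off_line\<close>.\<close>
    also have "\<dots> = (\<Sum>y\<in>?U. (if y = x then of_nat (q ^ 2) * (\<chi> x * cnj (\<chi> y)) else 0)
        + (if y \<in> ?D then of_nat q * (\<chi> x * cnj (\<chi> y)) else 0))"
      by (intro sum.cong refl, subst card_common_planes) (use x in \<open>auto intro: bexI[of _ 1]\<close>)
    also have "\<dots> = of_nat (q ^ 2) * (\<chi> x * cnj (\<chi> x)) + (\<Sum>y\<in>?D. of_nat q * (\<chi> x * cnj (\<chi> y)))"
    proof -
      have "?U \<inter> ?D = ?D" by (auto intro: bexI[of _ 0])
      then show ?thesis using x unfolding sum.distrib by (simp add: sum.If_cases)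
    qed
    also have "(\<Sum>y\<in>?D. of_nat q * (\<chi> x * cnj (\<chi> y))) = of_nat q * (\<chi> x * cnj (\<Sum>y\<in>?D. \<chi> y))"
      by (simp add: sum_distrib_left)
    finally show "(\<Sum>y\<in>?U. \<Sum>u\<in>UNIV. if tr (u * x) = 1 \<and> tr (u * y) = 1 then \<chi> x * cnj (\<chi> y) else 0) = of_nat (q ^ 2)"
      using sum_chi_off_line[OF x] chi_cnj[OF x] by (simp del: cnj_sum)
  qed
  also have "\<dots> = of_nat (q ^ 3 - 1) * of_nat (q ^ 2)"
    by (simp add: card_Diff_subset card_E)
  finally have "?P * cnj ?P = of_nat (q ^ 2)"
  proof -
    have "q ^ 3 - 1 \<noteq> 0" using q_gt_1 unfolding order_factor by (simp add: N_def)
    moreover assume "of_nat (q ^ 3 - 1) * (?P * cnj ?P) = of_nat (q ^ 3 - 1) * complex_of_nat (q ^ 2)"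
    ultimately show ?thesis by (metis mult_left_cancel of_nat_eq_0_iff)
  qed
  then have "(norm ?P) ^ 2 = real q ^ 2"
    by (metis complex_norm_square of_nat_power of_real_eq_iff of_real_of_nat_eq)
  then show ?thesis by (simp add: power2_eq_iff_nonneg)
qed

lemma norm_plane_sum: "u \<noteq> 0 \<Longrightarrow> norm (plane_sum u) = q"
  by (subst plane_sum_conj) (simp_all add: norm_mult norm_chi norm_plane_sum_1)

section \<open>Monic polynomials of degree 2 and 3 evaluated at \<open>a\<close>\<close>

lemma tr_common_kernel:
  assumes "u \<notin> F"
  obtains d where "d \<noteq> 0" "tr d = 0" "tr (u * d) = 0"
proof -
  have card: "card {x. tr (1 * x) = 0 \<and> tr (u * x) = 0} = q"
    by (rule card_tr_fibre2) (use assms in auto)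
  have "\<not> {x. tr (1 * x) = 0 \<and> tr (u * x) = 0} \<subseteq> {0}"
  proof
    assume "{x. tr (1 * x) = 0 \<and> tr (u * x) = 0} \<subseteq> {0}"
    then have "card {x. tr (1 * x) = 0 \<and> tr (u * x) = 0} \<le> card {0::'a}" by (intro card_mono) auto
    then show False using card q_gt_1 by simp
  qed
  then show ?thesis using that by auto
qed

text \<open>The span of 1 and \<open>a\<close> is the kernel of a trace functional, which is
  normalised at \<open>a ^ 2\<close>. So the values at \<open>a\<close> of the monic quadratics will
  form a plane off the origin.\<close>

lemma span_plane:
  assumes "a \<notin> F"
  obtains c where "c \<noteq> 0" "tr (c * a ^ 2) = 1" "bij_betw (\<lambda>(k1, k0). k1 * a + k0) (F \<times> F) {z. tr (c * z) = 0}"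
proof -
  obtain b where b: "b \<noteq> 0" "tr b = 0" "tr (b * a) = 0"
    using tr_common_kernel[OF assms] by (metis mult.commute)
  let ?h = "\<lambda>(k1, k0). k1 * a + k0"
  have inj: "inj_on ?h (F \<times> F)"
  proof (rule inj_onI, clarify)
    fix k1 k0 l1 l0 assume F: "k1 \<in> F" "k0 \<in> F" "l1 \<in> F" "l0 \<in> F" and eq: "k1 * a + k0 = l1 * a + l0"
    have "k1 = l1"
    proof (rule ccontr)
      assume "k1 \<noteq> l1"
      then have "a = (l0 - k0) / (k1 - l1)" using eq by (simp add: field_simps)
      then show False using assms F by simp
    qed
    then show "k1 = l1 \<and> k0 = l0" using eq by simp
  qed
  have "?h ` (F \<times> F) = {z. tr (b * z) = 0}"
  proof (rule card_seteq)
    show "?h ` (F \<times> F) \<subseteq> {z. tr (b * z) = 0}"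
    proof clarify
      fix k1 k0 assume F: "k1 \<in> F" "k0 \<in> F"
      then have "tr (b * (k1 * a + k0)) = k1 * tr (b * a) + k0 * tr b"
        using tr_add[of "k1 * (b * a)" "k0 * b"] tr_scale[of k1 "b * a"] tr_scale[of k0 b] by (simp add: algebra_simps)
      then show "tr (b * (k1 * a + k0)) = 0" using b by simp
    qed
    show "card {z. tr (b * z) = 0} \<le> card (?h ` (F \<times> F))"
      by (simp add: card_tr_fibre b card_image[OF inj] card_cartesian_product card_F power2_eq_square)
  qed simp
  then have bij: "bij_betw ?h (F \<times> F) {z. tr (b * z) = 0}"
    using inj by (simp add: bij_betw_def)
  \<comment> \<open>Otherwise multiplication by \<open>a\<close> would preserve the plane, and the
    functionals of \<open>b\<close> and \<open>b * a\<close> would share a kernel of size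
    \<open>q ^ 2\<close>, although they are independent.\<close>
  have nz: "tr (b * a ^ 2) \<noteq> 0"
  proof
    assume a2: "tr (b * a ^ 2) = 0"
    have "tr (b * a * z) = 0" if "tr (b * z) = 0" for z
    proof -
      have "z \<in> ?h ` (F \<times> F)" using that unfolding bij_betw_imp_surj_on[OF bij] by simp
      then obtain k1 k0 where F: "k1 \<in> F" "k0 \<in> F" and z: "z = k1 * a + k0" by auto
      have "tr (b * a * z) = k1 * tr (b * a ^ 2) + k0 * tr (b * a)"
        using F tr_add[of "k1 * (b * a ^ 2)" "k0 * (b * a)"] tr_scale[of k1 "b * a ^ 2"] tr_scale[of k0 "b * a"]
        by (simp add: z algebra_simps power2_eq_square)
      then show ?thesis using a2 b by simp
    qed
    then have "{z. tr (b * z) = 0 \<and> tr (b * a * z) = 0} = {z. tr (b * z) = 0}" by auto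
    moreover have "card {z. tr (b * z) = 0 \<and> tr (b * a * z) = 0} = q"
      by (rule card_tr_fibre2) (use assms b in \<open>auto simp: mult.commute\<close>)
    ultimately show False using card_tr_fibre[of b 0] b q_gt_1 by (simp add: power2_eq_square)
  qed
  define c where "c = inverse (tr (b * a ^ 2)) * b"
  have c: "tr (c * z) = inverse (tr (b * a ^ 2)) * tr (b * z)" for z
    using tr_scale[of "inverse (tr (b * a ^ 2))" "b * z"] by (simp add: c_def algebra_simps)
  show ?thesis
  proof (rule that[of c])
    show "c \<noteq> 0" using b nz by (simp add: c_def)
    show "tr (c * a ^ 2) = 1" using nz by (simp add: c)
    have "{z. tr (c * z) = 0} = {z. tr (b * z) = 0}" using nz by (simp add: c)
    then show "bij_betw ?h (F \<times> F) {z. tr (c * z) = 0}" using bij by simp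
  qed
qed

definition quadratic_sum :: "'a \<Rightarrow> complex" where
  "quadratic_sum a = (\<Sum>(k1, k0)\<in>F \<times> F. \<chi> (a ^ 2 + k1 * a + k0))"

text \<open>Adding \<open>a ^ 2\<close> moves the span of 1 and \<open>a\<close> to the plane
  \<open>tr (c * x) = 1\<close>, so this is a plane sum.\<close>

lemma norm_quadratic_sum:
  assumes "a \<notin> F"
  shows "norm (quadratic_sum a) = q"
proof -
  obtain c where c: "c \<noteq> 0" "tr (c * a ^ 2) = 1"
    and bij: "bij_betw (\<lambda>(k1, k0). k1 * a + k0) (F \<times> F) {z. tr (c * z) = 0}"
    using span_plane[OF assms] by blast
  have "quadratic_sum a = (\<Sum>z | tr (c * z) = 0. \<chi> (a ^ 2 + z))"
    unfolding quadratic_sum_def sum.reindex_bij_betw[OF bij, symmetric]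
    by (simp add: case_prod_unfold add.assoc)
  also have "\<dots> = plane_sum c"
    unfolding plane_sum_def
    by (rule sum.reindex_bij_witness[of _ "\<lambda>x. x - a ^ 2" "\<lambda>z. a ^ 2 + z"])
      (use c in \<open>auto simp: algebra_simps tr_add tr_diff\<close>)
  finally show ?thesis using norm_plane_sum c by simp
qed

text \<open>The elements 1, \<open>a\<close> and \<open>a ^ 2\<close> form a basis over
  \<open>F\<close>, so the monic cubics take each value at \<open>a\<close> exactly once. This is
  the vanishing of the third coefficient of the L-function.\<close>

lemma sum_chi_monic_cubics:
  assumes "a \<notin> F"
  shows "(\<Sum>(e1, e2, e3)\<in>F \<times> F \<times> F. \<chi> (a ^ 3 + e1 * a ^ 2 + e2 * a + e3)) = 0"
proof -
  obtain c where c: "c \<noteq> 0" "tr (c * a ^ 2) = 1"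
    and bij: "bij_betw (\<lambda>(k1, k0). k1 * a + k0) (F \<times> F) {z. tr (c * z) = 0}"
    using span_plane[OF assms] by blast
  let ?h = "\<lambda>(e1, e2, e3). a ^ 3 + e1 * a ^ 2 + e2 * a + e3"
  have inj: "inj_on ?h (F \<times> F \<times> F)"
  proof (rule inj_onI)
    fix x y assume xy: "x \<in> F \<times> F \<times> F" "y \<in> F \<times> F \<times> F" "?h x = ?h y"
    obtain e1 e2 e3 d1 d2 d3 where x: "x = (e1, e2, e3)" and y: "y = (d1, d2, d3)"
      by (metis prod_cases3)
    have F: "e1 \<in> F" "e2 \<in> F" "e3 \<in> F" "d1 \<in> F" "d2 \<in> F" "d3 \<in> F"
      using xy by (auto simp: x y)
    have eq: "a ^ 3 + e1 * a ^ 2 + e2 * a + e3 = a ^ 3 + d1 * a ^ 2 + d2 * a + d3"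
      using xy(3) by (simp add: x y)
    \<comment> \<open>The functional of \<open>c\<close> reads off the coefficient of
      \<open>a ^ 2\<close>.\<close>
    have *: "tr (c * (e * a ^ 2 + f * a + g)) = e" if "e \<in> F" "f \<in> F" "g \<in> F" for e f g
    proof -
      have "tr (c * (f * a + g)) = 0" using bij that by (auto simp: bij_betw_def)
      moreover have "tr (c * (e * a ^ 2 + f * a + g)) = e * tr (c * a ^ 2) + tr (c * (f * a + g))"
        using tr_add[of "e * (c * a ^ 2)" "c * (f * a + g)"] tr_scale[of e "c * a ^ 2"] that
        by (simp add: algebra_simps)
      ultimately show ?thesis using c by simp
    qed
    have "e1 * a ^ 2 + e2 * a + e3 = d1 * a ^ 2 + d2 * a + d3" using eq by (simp add: add.assoc)
    then have e1: "e1 = d1" using *[of e1 e2 e3] *[of d1 d2 d3] F by simp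
    then have "(\<lambda>(k1, k0). k1 * a + k0) (e2, e3) = (\<lambda>(k1, k0). k1 * a + k0) (d2, d3)"
      using eq by (simp add: add.assoc)
    then have "(e2, e3) = (d2, d3)"
      using bij F unfolding bij_betw_def inj_on_def by blast
    with e1 show "x = y" by (simp add: x y)
  qed
  have "card (?h ` (F \<times> F \<times> F)) = card (F \<times> F \<times> F)" by (rule card_image[OF inj])
  then have "card (?h ` (F \<times> F \<times> F)) = CARD('a)"
    by (simp only: card_cartesian_product card_F card_E power3_eq_cube mult.assoc)
  then have "?h ` (F \<times> F \<times> F) = UNIV" by (intro card_seteq) auto
  with inj have "bij_betw ?h (F \<times> F \<times> F) UNIV" by (simp only: bij_betw_def)
  from sum.reindex_bij_betw[OF this, of \<chi>] show ?thesis
    by (simp only: sum_chi case_prod_unfold)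
qed

end

section \<open>Counting monic cubics\<close>

text \<open>A monic cubic is encoded by its coefficient triple. The factors are
  \<open>x + t\<close>, so roots are negated and the coefficients carry no signs.\<close>

definition sym3 :: "'a::field \<times> 'a \<times> 'a \<Rightarrow> 'a \<times> 'a \<times> 'a" where
  "sym3 = (\<lambda>(x, y, z). (x + y + z, x * y + x * z + y * z, x * y * z))"

definition lin_quad :: "'a::field \<times> 'a \<times> 'a \<Rightarrow> 'a \<times> 'a \<times> 'a" where
  "lin_quad = (\<lambda>(t, k1, k0). (t + k1, t * k1 + k0, t * k0))"

definition cubic :: "'a::field \<times> 'a \<times> 'a \<Rightarrow> 'a \<Rightarrow> 'a" where
  "cubic = (\<lambda>(e1, e2, e3) x. x ^ 3 + e1 * x ^ 2 + e2 * x + e3)"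

lemma cubic_sym3: "cubic (sym3 (t, s, u)) x = (x + t) * (x + s) * (x + u)"
  by (simp add: cubic_def sym3_def algebra_simps power2_eq_square power3_eq_cube)

lemma cubic_lin_quad: "cubic (lin_quad (t, k1, k0)) x = (x + t) * (x ^ 2 + k1 * x + k0)"
  by (simp add: cubic_def lin_quad_def algebra_simps power2_eq_square power3_eq_cube)

lemma sym3_eq_lin_quad: "sym3 (t, s, u) = lin_quad (t, s + u, s * u)"
  by (simp add: sym3_def lin_quad_def algebra_simps)

lemma sym3_swap: "sym3 (s, t, u) = sym3 (t, s, u)" "sym3 (t, u, s) = sym3 (t, s, u)"
  by (simp_all add: sym3_def algebra_simps)

lemma sym3_root:
  assumes "sym3 (x, y, z) = sym3 (t, s, u)"
  shows "x \<in> {t, s, u}"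
proof -
  have "cubic (sym3 (x, y, z)) (- x) = 0" by (simp add: cubic_sym3)
  then have "(t - x) * (s - x) * (u - x) = 0" unfolding assms by (simp add: cubic_sym3 algebra_simps)
  then show ?thesis by auto
qed

context cubic_extension
begin

abbreviation conjugates :: "'a \<Rightarrow> 'a \<times> 'a \<times> 'a" where
  "conjugates y \<equiv> (y, y ^ q, (y ^ q) ^ q)"

lemma sym3_conjugates_in_F: "sym3 (conjugates y) \<in> F \<times> F \<times> F"
proof -
  let ?s2 = "y * y ^ q + y * (y ^ q) ^ q + y ^ q * (y ^ q) ^ q" and ?s3 = "y * y ^ q * (y ^ q) ^ q"
  have "?s2 ^ q = ?s2" "?s3 ^ q = ?s3" by (simp_all add: frob_add frob_mult algebra_simps)
  then have "?s2 \<in> F" "?s3 \<in> F" by (simp_all only: power_q_eq_iff)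
  with tr_in_F[of y] show ?thesis by (simp only: sym3_def tr_def case_prod_conv mem_Sigma_iff)
qed

text \<open>The multiplicity of a cubic as the product of \<open>x + y\<close> over the conjugates
  of \<open>y\<close>; these are the weights with which cubics enter
  \<open>norm_sum\<close>.\<close>

definition n_conj :: "'a \<times> 'a \<times> 'a \<Rightarrow> nat" where
  "n_conj e = card {y. sym3 (conjugates y) = e}"

definition n_split :: "'a \<times> 'a \<times> 'a \<Rightarrow> nat" where
  "n_split e = card {p \<in> F \<times> F \<times> F. sym3 p = e}"

definition n_root :: "'a \<times> 'a \<times> 'a \<Rightarrow> nat" where
  "n_root e = card {p \<in> F \<times> F \<times> F. lin_quad p = e}"

lemma n_conj_le_3: "n_conj e \<le> 3"
proof (cases "\<exists>y0. sym3 (conjugates y0) = e")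
  case True
  then obtain y0 where y0: "sym3 (conjugates y0) = e" by blast
  have "{y. sym3 (conjugates y) = e} \<subseteq> {y0, y0 ^ q, (y0 ^ q) ^ q}"
  proof
    fix y assume "y \<in> {y. sym3 (conjugates y) = e}"
    then have "sym3 (conjugates y) = sym3 (conjugates y0)" using y0 by simp
    then show "y \<in> {y0, y0 ^ q, (y0 ^ q) ^ q}" by (rule sym3_root)
  qed
  then have "n_conj e \<le> card {y0, y0 ^ q, (y0 ^ q) ^ q}"
    unfolding n_conj_def by (intro card_mono) auto
  also have "\<dots> \<le> 3" by (simp add: card_insert_if)
  finally show ?thesis .
qed (simp add: n_conj_def)

lemma conjugates_root_in_F:
  assumes "sym3 (conjugates y) = lin_quad (t, k1, k0)" "t \<in> F"
  shows "y = t"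
proof -
  have "cubic (sym3 (conjugates y)) (- t) = 0" unfolding assms(1) by (simp add: cubic_lin_quad)
  then have "y = t \<or> y ^ q = t \<or> (y ^ q) ^ q = t" by (auto simp: cubic_sym3)
  then show ?thesis using F_fixed[OF assms(2)] by (metis frob_eq_iff)
qed

lemma n_root_le:
  assumes "finite R" "\<And>t k1 k0. t \<in> F \<Longrightarrow> lin_quad (t, k1, k0) = e \<Longrightarrow> t \<in> R"
  shows "n_root e \<le> card R"
  unfolding n_root_def
proof (rule card_inj_on_le[of fst])
  show "inj_on fst {p \<in> F \<times> F \<times> F. lin_quad p = e}"
    by (rule inj_onI) (auto simp: lin_quad_def)
qed (use assms in auto)

lemma n_split_ge:
  assumes "P \<subseteq> F \<times> F \<times> F" "sym3 ` P \<subseteq> {e}"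
  shows "card P \<le> n_split e"
  unfolding n_split_def by (rule card_mono) (use assms in auto)

text \<open>A root in \<open>F\<close> forces some conjugate of \<open>y\<close>, hence
  \<open>y\<close> itself, to equal \<open>t\<close>, and then the cubic is the cube of
  \<open>x + t\<close>.\<close>

lemma n_conj_eq_0:
  assumes "lin_quad (t, k1, k0) = e" "t \<in> F" "e \<noteq> sym3 (t, t, t)"
  shows "n_conj e = 0"
proof -
  have "{y. sym3 (conjugates y) = e} = {}"
  proof (rule ccontr)
    assume "{y. sym3 (conjugates y) = e} \<noteq> {}"
    then obtain y where y: "sym3 (conjugates y) = e" by blast
    then have "y = t" using conjugates_root_in_F[of y t k1 k0] assms by simp
    then show False using y assms(2,3) by simp
  qed
  then show ?thesis by (simp add: n_conj_def)
qed

lemma lin_quad_root_sym3: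
  assumes "lin_quad (x, k1, k0) = sym3 (t, s, u)"
  shows "x \<in> {t, s, u}"
proof -
  have "cubic (lin_quad (x, k1, k0)) (- x) = 0" by (simp add: cubic_lin_quad)
  then have "(t - x) * (s - x) * (u - x) = 0" unfolding assms by (simp add: cubic_sym3 algebra_simps)
  then show ?thesis by auto
qed

lemma sym3_eq_triple:
  assumes "sym3 (t, s, u) = sym3 (x, x, x)"
  shows "t = x \<and> s = x \<and> u = x"
  using sym3_root[of t s u x x x] sym3_root[of s t u x x x] sym3_root[of u t s x x x] assms
  by (metis empty_iff insert_iff sym3_swap)

lemma cubic_count_le_split2:
  assumes "x \<in> F" "z \<in> F" "x \<noteq> z"
  shows "n_conj (sym3 (x, x, z)) + 3 * n_root (sym3 (x, x, z)) \<le> n_split (sym3 (x, x, z)) + 3"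
proof -
  let ?e = "sym3 (x, x, z)"
  have "n_conj ?e = 0"
    by (rule n_conj_eq_0[OF sym3_eq_lin_quad[symmetric]]) (use assms sym3_eq_triple in auto)
  moreover have "n_root ?e \<le> card {x, z}"
    by (rule n_root_le) (auto dest!: lin_quad_root_sym3)
  moreover have "card {x, z} = 2" using assms by simp
  moreover have "card {(x, x, z), (x, z, x), (z, x, x)} \<le> n_split ?e"
    by (rule n_split_ge) (use assms in \<open>auto simp: sym3_def algebra_simps\<close>)
  moreover have "card {(x, x, z), (x, z, x), (z, x, x)} = 3" using assms by simp
  ultimately show ?thesis by linarith
qed

lemma cubic_count_le_split:
  assumes "t \<in> F" "s \<in> F" "u \<in> F"
  shows "n_conj (sym3 (t, s, u)) + 3 * n_root (sym3 (t, s, u)) \<le> n_split (sym3 (t, s, u)) + 3"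
proof -
  let ?e = "sym3 (t, s, u)"
  consider "t = s" "s = u" | "t = s" "s \<noteq> u" | "t = u" "s \<noteq> u" | "s = u" "t \<noteq> s"
    | "t \<noteq> s" "s \<noteq> u" "t \<noteq> u" by blast
  then show ?thesis
  proof cases
    case 1
    have "{y. sym3 (conjugates y) = ?e} \<subseteq> {t}"
      using conjugates_root_in_F[OF _ assms(1), of _ "s + u" "s * u"] by (auto simp: sym3_eq_lin_quad[of t])
    then have "n_conj ?e \<le> card {t}" unfolding n_conj_def by (intro card_mono) auto
    moreover have "n_root ?e \<le> card {t}"
      by (rule n_root_le) (use 1 in \<open>auto dest!: lin_quad_root_sym3\<close>)
    moreover have "card {(t, t, t)} \<le> n_split ?e"
      by (rule n_split_ge) (use assms 1 in auto)
    ultimately show ?thesis by simp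
  next
    case 2
    then show ?thesis using cubic_count_le_split2[of t u] assms by simp
  next
    case 3
    then show ?thesis using cubic_count_le_split2[of t s] assms by (simp add: sym3_swap(2))
  next
    case 4
    then show ?thesis using cubic_count_le_split2[of s t] assms by (metis sym3_swap)
  next
    case 5
    have "n_conj ?e = 0"
      by (rule n_conj_eq_0[OF sym3_eq_lin_quad[symmetric]]) (use assms 5 sym3_eq_triple in auto)
    moreover have "n_root ?e \<le> card {t, s, u}"
      by (rule n_root_le) (auto dest!: lin_quad_root_sym3)
    moreover have "card {t, s, u} = 3" using 5 by simp
    moreover have "card {(t, s, u), (t, u, s), (s, t, u), (s, u, t), (u, t, s), (u, s, t)} \<le> n_split ?e"
      by (rule n_split_ge) (use assms in \<open>auto simp: sym3_def algebra_simps\<close>)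
    moreover have "card {(t, s, u), (t, u, s), (s, t, u), (s, u, t), (u, t, s), (u, s, t)} = 6"
      using 5 by simp
    ultimately show ?thesis by linarith
  qed
qed

text \<open>The triple \<open>(n_conj, n_root, n_split)\<close> is \<open>(3, 0, 0)\<close> for
  irreducible cubics, \<open>(0, 1, 0)\<close> with an irreducible quadratic factor, and
  \<open>(0, 3, 6)\<close>, \<open>(0, 2, 3)\<close> or \<open>(1, 1, 1)\<close> for split cubics
  with 3, 2 or 1 distinct roots. One-sided bounds on these entries suffice here.\<close>

lemma cubic_count_le: "n_conj e + 3 * n_root e \<le> n_split e + 3"
proof (cases "\<exists>t k1 k0. t \<in> F \<and> k1 \<in> F \<and> k0 \<in> F \<and> lin_quad (t, k1, k0) = e")
  case False
  then have "n_root e = 0" by (auto simp: n_root_def)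
  then show ?thesis using n_conj_le_3[of e] by simp
next
  case True
  then obtain t k1 k0 where F: "t \<in> F" "k1 \<in> F" "k0 \<in> F" and e: "lin_quad (t, k1, k0) = e" by blast
  \<comment> \<open>The case distinction is whether the quadratic factor has a root
    \<open>- s\<close> in \<open>F\<close>; its other root is then
    \<open>- (k1 - s)\<close>.\<close>
  show ?thesis
  proof (cases "\<exists>s\<in>F. s ^ 2 - k1 * s + k0 = 0")
    case True
    then obtain s where s: "s \<in> F" "s ^ 2 - k1 * s + k0 = 0" by blast
    have "k0 = s * (k1 - s)" using s(2) by (simp add: algebra_simps power2_eq_square eq_neg_iff_add_eq_0)
    then have "e = sym3 (t, s, k1 - s)" by (simp add: sym3_eq_lin_quad flip: e)
    then show ?thesis using cubic_count_le_split[of t s "k1 - s"] F s by simp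
  next
    case False
    have "n_root e \<le> card {t}"
    proof (rule n_root_le)
      fix x l1 l0 assume x: "x \<in> F" "lin_quad (x, l1, l0) = e"
      have "cubic (lin_quad (x, l1, l0)) (- x) = 0" by (simp add: cubic_lin_quad)
      then have "(t - x) * (x ^ 2 - k1 * x + k0) = 0"
        unfolding x(2) e[symmetric] by (simp add: cubic_lin_quad algebra_simps)
      then show "x \<in> {t}" using False x(1) by auto
    qed simp
    moreover have "e \<noteq> sym3 (t, t, t)"
    proof
      assume "e = sym3 (t, t, t)"
      then have "k1 = t + t" "k0 = t * t" using e by (auto simp: sym3_eq_lin_quad lin_quad_def)
      then have "t ^ 2 - k1 * t + k0 = 0" by (simp add: algebra_simps power2_eq_square)
      then show False using False F by blast
    qed
    then have "n_conj e = 0" using n_conj_eq_0[OF e F(1)] by blast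
    ultimately show ?thesis by simp
  qed
qed

lemma card_F3: "card (F \<times> F \<times> F) = q ^ 3"
  by (simp add: card_cartesian_product card_F power3_eq_cube)

lemma sum_n_conj:
  fixes h :: "'a \<times> 'a \<times> 'a \<Rightarrow> 'b::comm_semiring_1"
  shows "(\<Sum>y\<in>UNIV. h (sym3 (conjugates y))) = (\<Sum>e\<in>F \<times> F \<times> F. of_nat (n_conj e) * h e)"
  using sum_over_fibres[of UNIV "F \<times> F \<times> F" "\<lambda>y. sym3 (conjugates y)" h] sym3_conjugates_in_F
  by (auto simp: n_conj_def)

lemma sym3_image_F: "sym3 ` (F \<times> F \<times> F) \<subseteq> F \<times> F \<times> F"
  by (auto simp: sym3_def)

lemma lin_quad_image_F: "lin_quad ` (F \<times> F \<times> F) \<subseteq> F \<times> F \<times> F"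
  by (auto simp: lin_quad_def)

lemma sum_n_split:
  fixes h :: "'a \<times> 'a \<times> 'a \<Rightarrow> 'b::comm_semiring_1"
  shows "(\<Sum>p\<in>F \<times> F \<times> F. h (sym3 p)) = (\<Sum>e\<in>F \<times> F \<times> F. of_nat (n_split e) * h e)"
  using sum_over_fibres[of "F \<times> F \<times> F" "F \<times> F \<times> F" sym3 h]
  by (simp add: n_split_def sym3_image_F)

lemma sum_n_root:
  fixes h :: "'a \<times> 'a \<times> 'a \<Rightarrow> 'b::comm_semiring_1"
  shows "(\<Sum>p\<in>F \<times> F \<times> F. h (lin_quad p)) = (\<Sum>e\<in>F \<times> F \<times> F. of_nat (n_root e) * h e)"
  using sum_over_fibres[of "F \<times> F \<times> F" "F \<times> F \<times> F" lin_quad h]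
  by (simp add: n_root_def lin_quad_image_F)

text \<open>Both sides have the same total over all monic cubics, so the termwise inequality is an equality.\<close>

lemma cubic_count:
  assumes "e \<in> F \<times> F \<times> F"
  shows "n_conj e + 3 * n_root e = n_split e + 3"
proof (rule sum_mono_inv[of _ "F \<times> F \<times> F"])
  have "sum n_conj (F \<times> F \<times> F) = q ^ 3" "sum n_split (F \<times> F \<times> F) = q ^ 3" "sum n_root (F \<times> F \<times> F) = q ^ 3"
    using sum_n_conj[of "\<lambda>_. 1::nat"] sum_n_split[of "\<lambda>_. 1::nat"] sum_n_root[of "\<lambda>_. 1::nat"] card_E card_F3
    by simp_all
  then show "(\<Sum>e\<in>F \<times> F \<times> F. n_conj e + 3 * n_root e) = (\<Sum>e\<in>F \<times> F \<times> F. n_split e + 3)"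
    using card_F3 by (simp add: sum.distrib flip: sum_distrib_left)
qed (use assms cubic_count_le in auto)

definition line_sum :: "'a \<Rightarrow> complex" where
  "line_sum a = (\<Sum>t\<in>F. \<chi> (a + t))"

definition norm_sum :: "'a \<Rightarrow> complex" where
  "norm_sum a = (\<Sum>y\<in>UNIV. \<chi> ((y + a) * (y + a ^ q) * (y + (a ^ q) ^ q)))"

text \<open>This is Newton's identity for the power sums of the inverse roots of the L-function
  \<open>1 + line_sum a * T + quadratic_sum a * T\<^sup>2\<close>.\<close>

lemma norm_sum_eq:
  assumes "a \<notin> F"
  shows "norm_sum a = line_sum a ^ 3 - 3 * quadratic_sum a * line_sum a"
proof -
  let ?h = "\<lambda>e. \<chi> (cubic e a)" and ?F = "F \<times> F \<times> F"
  have "norm_sum a = (\<Sum>y\<in>UNIV. ?h (sym3 (conjugates y)))"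
    unfolding norm_sum_def
  proof (rule sum.cong[OF refl])
    fix y
    \<comment> \<open>Applying the Frobenius map inside \<open>\<chi>\<close> moves the conjugation
      from \<open>a\<close> to \<open>y\<close>, so that a cubic over \<open>F\<close> is evaluated
      at \<open>a\<close>.\<close>
    have "\<chi> (y + a ^ q) = \<chi> (a + (y ^ q) ^ q)"
      using chi_frob[of "y + a ^ q"] chi_frob[of "(y + a ^ q) ^ q"] by (simp add: frob_add add.commute)
    moreover have "\<chi> (y + (a ^ q) ^ q) = \<chi> (a + y ^ q)"
      using chi_frob[of "y + (a ^ q) ^ q"] by (simp add: frob_add add.commute)
    ultimately show "\<chi> ((y + a) * (y + a ^ q) * (y + (a ^ q) ^ q)) = ?h (sym3 (conjugates y))"
      by (simp add: cubic_sym3 chi_mult add.commute)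
  qed
  then have A: "norm_sum a = (\<Sum>e\<in>?F. of_nat (n_conj e) * ?h e)"
    by (simp add: sum_n_conj[of ?h])
  have "(\<Sum>p\<in>?F. ?h (sym3 p)) = (\<Sum>(t, s, u)\<in>?F. \<chi> (a + t) * (\<chi> (a + s) * \<chi> (a + u)))"
    by (rule sum.cong[OF refl]) (auto simp: cubic_sym3 chi_mult mult.assoc)
  also have "\<dots> = line_sum a * (line_sum a * line_sum a)"
    unfolding line_sum_def sum.cartesian_product[symmetric] sum_product by (simp add: sum_distrib_left)
  finally have "line_sum a ^ 3 = (\<Sum>p\<in>?F. ?h (sym3 p))"
    by (simp add: power3_eq_cube mult.assoc)
  then have B: "line_sum a ^ 3 = (\<Sum>e\<in>?F. of_nat (n_split e) * ?h e)"
    by (simp only: sum_n_split[of ?h])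
  have "(\<Sum>p\<in>?F. ?h (lin_quad p)) = (\<Sum>(t, k)\<in>F \<times> F \<times> F. \<chi> (a + t) * (case k of (k1, k0) \<Rightarrow> \<chi> (a ^ 2 + k1 * a + k0)))"
    by (rule sum.cong[OF refl]) (auto simp: cubic_lin_quad chi_mult)
  also have "\<dots> = line_sum a * quadratic_sum a"
    unfolding line_sum_def quadratic_sum_def sum_product sum.cartesian_product ..
  finally have "quadratic_sum a * line_sum a = (\<Sum>p\<in>?F. ?h (lin_quad p))"
    by (simp add: mult.commute)
  then have C: "quadratic_sum a * line_sum a = (\<Sum>e\<in>?F. of_nat (n_root e) * ?h e)"
    by (simp only: sum_n_root[of ?h])
  have D: "(\<Sum>e\<in>?F. ?h e) = 0"
    using sum_chi_monic_cubics[OF assms] by (simp add: cubic_def case_prod_unfold)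
  have "norm_sum a + 3 * (quadratic_sum a * line_sum a) = (\<Sum>e\<in>?F. of_nat (n_conj e + 3 * n_root e) * ?h e)"
    unfolding A C by (simp add: sum_distrib_left sum.distrib[symmetric] algebra_simps)
  also have "\<dots> = (\<Sum>e\<in>?F. of_nat (n_split e + 3) * ?h e)"
    by (rule sum.cong[OF refl]) (simp only: cubic_count)
  also have "\<dots> = line_sum a ^ 3 + 3 * (\<Sum>e\<in>?F. ?h e)"
    unfolding B by (simp add: sum_distrib_left sum.distrib algebra_simps)
  finally show ?thesis by (simp add: D algebra_simps)
qed

section \<open>Jacobi sums\<close>

text \<open>The quadratic character of \<open>E\<close>.\<close>

definition \<eta> :: "'a \<Rightarrow> complex" where "\<eta> x = \<chi> x ^ 2"

lemma eta_0 [simp]: "\<eta> 0 = 0" by (simp add: \<eta>_def)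

lemma eta_1 [simp]: "\<eta> 1 = 1" by (simp add: \<eta>_def)

lemma eta_mult: "\<eta> (x * y) = \<eta> x * \<eta> y" by (simp add: \<eta>_def chi_mult power_mult_distrib)

lemma eta_sq: "x \<noteq> 0 \<Longrightarrow> \<eta> x * \<eta> x = 1"
  using chi_power_4[of x] by (simp add: \<eta>_def flip: power_add)

lemma eta_square: "x \<noteq> 0 \<Longrightarrow> \<eta> (x ^ 2) = 1"
  using eta_sq[of x] by (simp add: power2_eq_square eta_mult)

lemma eta_cases: "x \<noteq> 0 \<Longrightarrow> \<eta> x = 1 \<or> \<eta> x = -1"
  using eta_sq[of x] by (simp add: square_eq_1_iff)

lemma eta_eq_1_imp_square:
  assumes "\<eta> x = 1"
  obtains s where "x = s ^ 2"
proof -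
  have "x \<noteq> 0" using assms by auto
  then obtain k where k: "x = \<omega> ^ k" using omega_power[of x] by auto
  have "(-1) ^ k = (1::complex)"
    using assms by (simp add: \<eta>_def k chi_omega_power power2_eq_square flip: power_mult_distrib)
  then have "even k" by (cases "even k") auto
  then obtain j where "k = 2 * j" by auto
  then have "x = (\<omega> ^ j) ^ 2" by (simp add: k mult.commute flip: power_mult)
  then show ?thesis using that by blast
qed

text \<open>The witness \<open>\<omega> ^ m\<close> with \<open>4 * m = q ^ 3 - 1\<close> has fourth
  power 1 but square different from 1.\<close>

lemma minus_1_square: obtains \<iota> :: 'a where "\<iota> ^ 2 = -1"
proof -
  let ?n = "q ^ 3 - 1"
  obtain m where m: "?n = 4 * m" using four_dvd_order by auto
  have m0: "m > 0" using m q_gt_1 unfolding order_factor by (cases m) (auto simp: N_def)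
  have "(\<omega> ^ m) ^ 4 = 1" using power_order[of \<omega>] m by (simp add: mult.commute flip: power_mult)
  then have "((\<omega> ^ m) ^ 2 - 1) * ((\<omega> ^ m) ^ 2 + 1) = 0" by (simp add: algebra_simps flip: power_add)
  moreover have "(\<omega> ^ m) ^ 2 \<noteq> 1"
  proof
    assume "(\<omega> ^ m) ^ 2 = 1"
    then have "?n dvd m * 2" using has_mult_order_power_eq_1_iff[OF omega_order, of "m * 2"] by (simp add: power_mult)
    then show False unfolding m using m0 by (auto dest: dvd_imp_le)
  qed
  ultimately have "(\<omega> ^ m) ^ 2 + 1 = 0" by (metis mult_eq_0_iff right_minus_eq)
  then show ?thesis using that[of "\<omega> ^ m"] by (simp add: eq_neg_iff_add_eq_0)
qed

text \<open>In characteristic 2 the element \<open>\<omega> ^ (2 * m)\<close>, whose square is 1,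
  would itself be 1, against the order of \<open>\<omega>\<close>.\<close>

lemma two_neq_0: "(2::'a) \<noteq> 0"
proof
  assume 2: "(2::'a) = 0"
  obtain m where m: "q ^ 3 - 1 = 4 * m" using four_dvd_order by auto
  have m0: "m > 0" using m q_gt_1 unfolding order_factor by (cases m) (auto simp: N_def)
  let ?x = "\<omega> ^ (2 * m)"
  have "?x ^ 2 = 1" using power_order[of \<omega>] m by (simp add: mult.commute mult.left_commute flip: power_mult)
  then have "(?x - 1) ^ 2 = - 2 * (?x - 1)" by (simp add: power2_eq_square algebra_simps)
  then have "?x = 1" using 2 by simp
  then have "4 * m dvd 2 * m" using has_mult_order_power_eq_1_iff[OF omega_order] m by metis
  then show False using m0 by (auto dest: dvd_imp_le)
qed

lemma eta_4: "\<eta> (4 * x) = \<eta> x"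
proof -
  have "(4::'a) = 2 ^ 2" by simp
  then show ?thesis using eta_square[OF two_neq_0] by (simp only: eta_mult mult_1)
qed

text \<open>The quotient \<open>(w + \<alpha>) / (w + \<beta>)\<close> differs from the product by a
  square and takes every value but 1, so the full sum of \<open>\<eta>\<close> lacks only
  \<open>\<eta> 1\<close>.\<close>

lemma sum_eta_quadratic:
  assumes "\<alpha> \<noteq> \<beta>"
  shows "(\<Sum>w\<in>UNIV. \<eta> ((w + \<alpha>) * (w + \<beta>))) = -1"
proof -
  have "(\<Sum>w\<in>UNIV. \<eta> ((w + \<alpha>) * (w + \<beta>))) = (\<Sum>w\<in>UNIV - {-\<beta>}. \<eta> ((w + \<alpha>) * (w + \<beta>)))"
    by (rule sum.mono_neutral_right) auto
  also have "\<dots> = (\<Sum>v\<in>UNIV - {1}. \<eta> v)"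
  proof (rule sum.reindex_bij_witness[of _ "\<lambda>v. (\<alpha> - \<beta>) / (v - 1) - \<beta>" "\<lambda>w. (w + \<alpha>) / (w + \<beta>)"])
    fix w assume "w \<in> UNIV - {-\<beta>}"
    then have w: "w + \<beta> \<noteq> 0" by (auto simp: eq_neg_iff_add_eq_0)
    have eq: "(w + \<alpha>) / (w + \<beta>) - 1 = (\<alpha> - \<beta>) / (w + \<beta>)" using w by (simp add: field_simps)
    then show "(\<alpha> - \<beta>) / ((w + \<alpha>) / (w + \<beta>) - 1) - \<beta> = w" using w assms by simp
    show "(w + \<alpha>) / (w + \<beta>) \<in> UNIV - {1}" using w assms by auto
    have "(w + \<alpha>) * (w + \<beta>) = ((w + \<alpha>) / (w + \<beta>)) * (w + \<beta>) ^ 2"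
      using w by (simp add: power2_eq_square)
    then show "\<eta> ((w + \<alpha>) / (w + \<beta>)) = \<eta> ((w + \<alpha>) * (w + \<beta>))"
      using eta_square[OF w] by (metis eta_mult mult.right_neutral)
  next
    fix v :: 'a assume "v \<in> UNIV - {1}"
    then have v: "v - 1 \<noteq> 0" by auto
    then show "(\<alpha> - \<beta>) / (v - 1) - \<beta> \<in> UNIV - {- \<beta>}" using assms by auto
    have "(\<alpha> - \<beta>) / (v - 1) - \<beta> + \<alpha> = v * ((\<alpha> - \<beta>) / (v - 1))" using v by (simp add: field_simps)
    then show "((\<alpha> - \<beta>) / (v - 1) - \<beta> + \<alpha>) / ((\<alpha> - \<beta>) / (v - 1) - \<beta> + \<beta>) = v"
      using v assms by simp
  qed
  also have "\<dots> = (\<Sum>v\<in>UNIV. \<eta> v) - \<eta> 1"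
    by (subst sum_diff1) auto
  also have "\<dots> = -1" using sum_chi_power[of 2] by (simp add: \<eta>_def)
  finally show ?thesis .
qed

text \<open>The Jacobi sum of \<open>\<chi>\<close> and \<open>\<eta>\<close> up to the factor
  \<open>\<chi> (-1)\<close>, with \<open>w + 1\<close> in place of \<open>1 - w\<close>.\<close>

definition jacobi_sum :: complex where
  "jacobi_sum = (\<Sum>w\<in>UNIV. \<chi> w * \<eta> (w + 1))"

lemma cnj_eta: "cnj (\<eta> x) = \<eta> x"
  using eta_cases[of x] by (cases "x = 0") auto

text \<open>Substituting \<open>w = v * w'\<close> in the double sum leaves an inner sum of
  \<open>\<eta>\<close> over a quadratic in \<open>w'\<close>, which is known. Orthogonality removes
  everything but the main term at \<open>v = 1\<close>.\<close>

lemma norm_jacobi_sum: "(norm jacobi_sum) ^ 2 = real q ^ 3"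
proof -
  let ?U = "UNIV - {0::'a}"
  have J: "jacobi_sum = (\<Sum>w\<in>?U. \<chi> w * \<eta> (w + 1))"
    unfolding jacobi_sum_def by (rule sum.mono_neutral_right) auto
  have "jacobi_sum * cnj jacobi_sum = (\<Sum>w'\<in>?U. \<Sum>w\<in>?U. (\<chi> w * \<eta> (w + 1)) * (cnj (\<chi> w') * \<eta> (w' + 1)))"
    unfolding J by (simp add: sum_product cnj_eta) (rule sum.swap)
  also have "\<dots> = (\<Sum>w'\<in>?U. \<Sum>v\<in>?U. \<chi> v * \<eta> ((v * w' + 1) * (w' + 1)))"
  proof (rule sum.cong[OF refl])
    fix w' assume "w' \<in> ?U"
    then have w': "w' \<noteq> 0" by simp
    show "(\<Sum>w\<in>?U. (\<chi> w * \<eta> (w + 1)) * (cnj (\<chi> w') * \<eta> (w' + 1))) = (\<Sum>v\<in>?U. \<chi> v * \<eta> ((v * w' + 1) * (w' + 1)))"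
      by (rule sum.reindex_bij_witness[of _ "\<lambda>v. v * w'" "\<lambda>w. w / w'"])
        (use w' in \<open>auto simp: divide_inverse chi_mult chi_inverse eta_mult mult_ac\<close>)
  qed
  also have "\<dots> = (\<Sum>v\<in>?U. \<chi> v * (\<Sum>w'\<in>?U. \<eta> ((v * w' + 1) * (w' + 1))))"
    by (subst sum.swap) (simp add: sum_distrib_left)
  also have "\<dots> = (\<Sum>v\<in>?U. (if v = 1 then of_nat (q ^ 3) else 0) - (\<chi> v ^ 3 + \<chi> v))"
  proof (rule sum.cong[OF refl])
    fix v assume "v \<in> ?U"
    then have v: "v \<noteq> 0" by simp
    have "(\<Sum>w'\<in>?U. \<eta> ((v * w' + 1) * (w' + 1))) = (\<Sum>w'\<in>UNIV. \<eta> ((v * w' + 1) * (w' + 1))) - 1"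
      by (subst sum_diff1) auto
    also have "(\<Sum>w'\<in>UNIV. \<eta> ((v * w' + 1) * (w' + 1))) = (if v = 1 then of_nat (q ^ 3) - 1 else - \<eta> v)"
    proof (cases "v = 1")
      case True
      have "(\<Sum>w'\<in>UNIV. \<eta> ((w' + 1) * (w' + 1))) = (\<Sum>w'\<in>UNIV - {-1::'a}. 1)"
        by (rule sum.mono_neutral_cong_right) (auto simp: eta_mult eta_sq eq_neg_iff_add_eq_0)
      also have "\<dots> = of_nat (q ^ 3) - 1"
        by (subst sum_diff1) (auto simp: card_E)
      finally show ?thesis using True by simp
    next
      case False
      have "v * w' + 1 = v * (w' + inverse v)" for w'
        using v by (simp add: distrib_left)
      then have "\<eta> ((v * w' + 1) * (w' + 1)) = \<eta> v * \<eta> ((w' + inverse v) * (w' + 1))" for w'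
        by (simp only: eta_mult mult.assoc)
      then have "(\<Sum>w'\<in>UNIV. \<eta> ((v * w' + 1) * (w' + 1))) = \<eta> v * (\<Sum>w'\<in>UNIV. \<eta> ((w' + inverse v) * (w' + 1)))"
        by (simp add: sum_distrib_left)
      also have "\<dots> = - \<eta> v" using False v by (subst sum_eta_quadratic) (auto simp: field_simps)
      finally show ?thesis using False by simp
    qed
    finally have "(\<Sum>w'\<in>?U. \<eta> ((v * w' + 1) * (w' + 1))) = (if v = 1 then of_nat (q ^ 3) - 1 else - \<eta> v) - 1" .
    then show "\<chi> v * (\<Sum>w'\<in>?U. \<eta> ((v * w' + 1) * (w' + 1))) = (if v = 1 then of_nat (q ^ 3) else 0) - (\<chi> v ^ 3 + \<chi> v)"
      by (simp only:) (simp add: \<eta>_def algebra_simps power2_eq_square power3_eq_cube)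
  qed
  also have "\<dots> = of_nat (q ^ 3) - ((\<Sum>v\<in>?U. \<chi> v ^ 3) + (\<Sum>v\<in>?U. \<chi> v))"
    by (simp add: sum_subtractf sum.distrib)
  also have "(\<Sum>v\<in>?U. \<chi> v ^ 3) = (\<Sum>v\<in>UNIV. \<chi> v ^ 3)"
    by (rule sum.mono_neutral_left) auto
  also have "(\<Sum>v\<in>?U. \<chi> v) = (\<Sum>v\<in>UNIV. \<chi> v)"
    by (rule sum.mono_neutral_left) auto
  finally have "jacobi_sum * cnj jacobi_sum = of_nat (q ^ 3)"
    by (simp add: sum_chi sum_chi_power)
  then have "complex_of_real ((norm jacobi_sum) ^ 2) = complex_of_real (real q ^ 3)"
    unfolding complex_norm_square by simp
  then show ?thesis by (simp only: of_real_eq_iff)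
qed

text \<open>For \<open>y + \<mu>\<^sup>2 / y = w\<close> one has \<open>(y - \<mu>)\<^sup>2 = y (w - 2 \<mu>)\<close>, so \<open>y\<close> and \<open>w - 2 \<mu>\<close> agree up to squares.\<close>

lemma sum_eta_fibre:
  assumes "\<mu> \<noteq> 0"
  shows "(\<Sum>y | y ^ 2 - w * y + \<mu> ^ 2 = 0. \<eta> y) = \<eta> (w - 2 * \<mu>) + \<eta> (w + 2 * \<mu>)"
proof -
  let ?Y = "{y. y ^ 2 - w * y + \<mu> ^ 2 = 0}"
  have 4: "(4::'a) = 2 * 2" by simp
  have four_neq_0: "(4::'a) \<noteq> 0" unfolding 4 using two_neq_0 by (simp del: mult_numeral_left_semiring_numeral numeral_times_numeral)
  \<comment> \<open>In the first two cases the quadratic is a square with a single root, and one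
    term on the right is \<open>\<eta> 0\<close>. In the third, \<open>\<eta>\<close> of the
    discriminant decides between two roots and none.\<close>
  consider "w = 2 * \<mu>" | "w = - (2 * \<mu>)" | "w - 2 * \<mu> \<noteq> 0" "w + 2 * \<mu> \<noteq> 0"
    by (auto simp: eq_neg_iff_add_eq_0)
  then show ?thesis
  proof cases
    case 1
    have "y ^ 2 - w * y + \<mu> ^ 2 = (y - \<mu>) ^ 2" for y by (simp add: 1 power2_eq_square algebra_simps)
    then have "?Y = {\<mu>}" by auto
    moreover have "w + 2 * \<mu> = 4 * \<mu>" by (simp add: 1)
    ultimately show ?thesis by (simp add: 1 eta_4)
  next
    case 2
    have "y ^ 2 - w * y + \<mu> ^ 2 = (y + \<mu>) ^ 2" for y by (simp add: 2 power2_eq_square algebra_simps)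
    then have "?Y = {- \<mu>}" by (auto simp: eq_neg_iff_add_eq_0)
    moreover have "w - 2 * \<mu> = 4 * - \<mu>" by (simp add: 2)
    ultimately show ?thesis using eta_4[of "- \<mu>"] by (simp add: 2)
  next
    case 3
    let ?d = "(w - 2 * \<mu>) * (w + 2 * \<mu>)"
    have eta_y: "\<eta> y = \<eta> (w - 2 * \<mu>)" if "y \<in> ?Y" for y
    proof -
      have y: "y ^ 2 = w * y - \<mu> ^ 2" using that by (simp add: algebra_simps eq_neg_iff_add_eq_0)
      have eq: "(y - \<mu>) ^ 2 = y * (w - 2 * \<mu>)" using y by (simp add: power2_eq_square algebra_simps)
      have "y \<noteq> 0" using y assms by auto
      then have "y - \<mu> \<noteq> 0" using eq 3 by auto
      then have "\<eta> y * \<eta> (w - 2 * \<mu>) = 1" using eta_square[of "y - \<mu>"] by (simp add: eq eta_mult)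
      then show ?thesis using eta_cases[OF \<open>y \<noteq> 0\<close>] eta_cases[OF 3(1)] by auto
    qed
    show ?thesis
    proof (cases "\<eta> ?d = 1")
      case True
      obtain s where s: "?d = s ^ 2" using eta_eq_1_imp_square[OF True] by blast
      then have "s \<noteq> 0" using 3 by auto
      have s': "s ^ 2 = w * w - 4 * (\<mu> * \<mu>)" unfolding s[symmetric] by (simp add: algebra_simps)
      have fac: "y ^ 2 - w * y + \<mu> ^ 2 = (y - (w + s) / 2) * (y - (w - s) / 2)" for y
      proof -
        have "2 * (y - v / 2) = 2 * y - v" for v
          using two_neq_0 by (simp add: right_diff_distrib)
        then have "(2 * (y - (w + s) / 2)) * (2 * (y - (w - s) / 2)) = (2 * y - (w + s)) * (2 * y - (w - s))"
          by (simp only:)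
        then have "4 * ((y - (w + s) / 2) * (y - (w - s) / 2)) = (2 * y - (w + s)) * (2 * y - (w - s))"
          by (simp only: 4 mult_ac)
        also have "\<dots> = 4 * y ^ 2 - 4 * w * y + w ^ 2 - s ^ 2" by (simp add: power2_eq_square algebra_simps)
        also have "\<dots> = 4 * (y ^ 2 - w * y + \<mu> ^ 2)" unfolding s' by (simp add: power2_eq_square algebra_simps)
        finally show ?thesis using four_neq_0 by (metis mult_left_cancel)
      qed
      have Y: "?Y = {(w + s) / 2, (w - s) / 2}" by (auto simp: fac)
      moreover have "(w + s) / 2 \<noteq> (w - s) / 2"
      proof
        assume "(w + s) / 2 = (w - s) / 2"
        then have "2 * s = 0" using two_neq_0 four_neq_0 by (simp add: field_simps)
        then show False using \<open>s \<noteq> 0\<close> two_neq_0 by (metis mult_eq_0_iff)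
      qed
      ultimately have "card ?Y = 2" by simp
      moreover have "(\<Sum>y\<in>?Y. \<eta> y) = of_nat (card ?Y) * \<eta> (w - 2 * \<mu>)"
        using eta_y by simp
      moreover have "\<eta> (w + 2 * \<mu>) = \<eta> (w - 2 * \<mu>)"
        using True eta_cases[OF 3(1)] eta_cases[OF 3(2)] by (auto simp: eta_mult)
      ultimately show ?thesis by simp
    next
      case False
      have "?Y = {}"
      proof (rule ccontr)
        assume "?Y \<noteq> {}"
        then obtain y where y: "y ^ 2 - w * y + \<mu> ^ 2 = 0" by blast
        have "?d = (2 * y - w) ^ 2 - 4 * (y ^ 2 - w * y + \<mu> ^ 2)"
          by (simp add: power2_eq_square algebra_simps)
        then have d: "?d = (2 * y - w) ^ 2" unfolding y by simp
        then have "2 * y - w \<noteq> 0" using 3 by auto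
        then show False using False eta_square d by simp
      qed
      then have "(\<Sum>y\<in>?Y. \<eta> y) = 0" by simp
      moreover have "\<eta> (w - 2 * \<mu>) + \<eta> (w + 2 * \<mu>) = 0"
        using False eta_cases[OF 3(1)] eta_cases[OF 3(2)] by (auto simp: eta_mult)
      ultimately show ?thesis by simp
    qed
  qed
qed

lemma sum_chi_eta_shift:
  assumes "c \<noteq> 0"
  shows "(\<Sum>w\<in>UNIV. \<chi> w * \<eta> (w + c ^ 2)) = \<eta> c * jacobi_sum"
proof -
  have "(\<Sum>w\<in>UNIV. \<chi> w * \<eta> (w + c ^ 2)) = (\<Sum>w\<in>UNIV. \<chi> (c ^ 2 * w) * \<eta> (c ^ 2 * w + c ^ 2))"
    by (rule sum.reindex_bij_witness[of _ "\<lambda>w. c ^ 2 * w" "\<lambda>w. w / c ^ 2"]) (use assms in auto)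
  also have "\<dots> = (\<Sum>w\<in>UNIV. \<chi> (c ^ 2) * \<eta> (c ^ 2) * (\<chi> w * \<eta> (w + 1)))"
  proof (rule sum.cong[OF refl])
    fix w
    have "c ^ 2 * w + c ^ 2 = c ^ 2 * (w + 1)" by (simp add: algebra_simps)
    then show "\<chi> (c ^ 2 * w) * \<eta> (c ^ 2 * w + c ^ 2) = \<chi> (c ^ 2) * \<eta> (c ^ 2) * (\<chi> w * \<eta> (w + 1))"
      by (simp only: chi_mult eta_mult mult_ac)
  qed
  also have "\<dots> = \<eta> c * jacobi_sum"
    using eta_square[OF assms] by (simp add: jacobi_sum_def sum_distrib_left \<eta>_def chi_power)
  finally show ?thesis .
qed

text \<open>With \<open>w = y + \<mu> ^ 2 / y\<close> the argument is
  \<open>y ^ 2 * (w - 1 - \<mu> ^ 2)\<close>. Grouping by \<open>w\<close> leaves the fibre sums of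
  \<open>\<eta>\<close>, and shifting \<open>w\<close> by \<open>1 + \<mu> ^ 2\<close> turns
  \<open>w - 2 * \<mu>\<close> and \<open>w + 2 * \<mu>\<close> into shifts by squares, that is, two
  scaled Jacobi sums.\<close>

lemma sum_chi_legendre:
  assumes "\<mu> \<noteq> 0" "\<mu> ^ 2 \<noteq> 1"
  shows "(\<Sum>y\<in>UNIV. \<chi> (y * (y - 1) * (y - \<mu> ^ 2))) = (\<eta> (1 - \<mu>) + \<eta> (1 + \<mu>)) * jacobi_sum"
proof -
  let ?U = "UNIV - {0::'a}"
  let ?w = "\<lambda>y. y + \<mu> ^ 2 / y"
  have nz: "1 - \<mu> \<noteq> 0" "1 + \<mu> \<noteq> 0"
  proof -
    have "(1 - \<mu>) * (1 + \<mu>) = 1 - \<mu> ^ 2" by (simp add: algebra_simps power2_eq_square)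
    then have "(1 - \<mu>) * (1 + \<mu>) \<noteq> 0" using assms by simp
    then show "1 - \<mu> \<noteq> 0" "1 + \<mu> \<noteq> 0" by auto
  qed
  have "(\<Sum>y\<in>UNIV. \<chi> (y * (y - 1) * (y - \<mu> ^ 2))) = (\<Sum>y\<in>?U. \<eta> y * \<chi> (?w y - 1 - \<mu> ^ 2))"
  proof (rule sum.mono_neutral_cong_right)
    fix y assume "y \<in> ?U"
    then have "y * (y - 1) * (y - \<mu> ^ 2) = y ^ 2 * (?w y - 1 - \<mu> ^ 2)"
      by (simp add: field_simps power2_eq_square)
    then show "\<chi> (y * (y - 1) * (y - \<mu> ^ 2)) = \<eta> y * \<chi> (?w y - 1 - \<mu> ^ 2)"
      by (simp add: chi_mult \<eta>_def chi_power)
  qed auto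
  also have "\<dots> = (\<Sum>w\<in>UNIV. \<Sum>y\<in>{y\<in>?U. ?w y = w}. \<eta> y * \<chi> (?w y - 1 - \<mu> ^ 2))"
    by (rule sum.group[symmetric]) auto
  also have "\<dots> = (\<Sum>w\<in>UNIV. (\<eta> (w - 2 * \<mu>) + \<eta> (w + 2 * \<mu>)) * \<chi> (w - 1 - \<mu> ^ 2))"
  proof (rule sum.cong[OF refl])
    fix w
    have "{y\<in>?U. ?w y = w} = {y. y ^ 2 - w * y + \<mu> ^ 2 = 0}"
    proof (rule Collect_cong)
      fix y show "(y \<in> ?U \<and> ?w y = w) = (y ^ 2 - w * y + \<mu> ^ 2 = 0)"
      proof (cases "y = 0")
        case False
        have "y ^ 2 - w * y + \<mu> ^ 2 = y * (?w y - w)" using False by (simp add: field_simps power2_eq_square)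
        then show ?thesis using False by simp
      qed (use assms in simp)
    qed
    then have "(\<Sum>y\<in>{y\<in>?U. ?w y = w}. \<eta> y) = \<eta> (w - 2 * \<mu>) + \<eta> (w + 2 * \<mu>)"
      using sum_eta_fibre[OF assms(1)] by simp
    then show "(\<Sum>y\<in>{y\<in>?U. ?w y = w}. \<eta> y * \<chi> (?w y - 1 - \<mu> ^ 2)) = (\<eta> (w - 2 * \<mu>) + \<eta> (w + 2 * \<mu>)) * \<chi> (w - 1 - \<mu> ^ 2)"
      by (simp flip: sum_distrib_right)
  qed
  also have "\<dots> = (\<Sum>w\<in>UNIV. \<chi> w * \<eta> (w + (1 - \<mu>) ^ 2) + \<chi> w * \<eta> (w + (1 + \<mu>) ^ 2))"
    by (rule sum.reindex_bij_witness[of _ "\<lambda>w. w + 1 + \<mu> ^ 2" "\<lambda>w. w - 1 - \<mu> ^ 2"])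
      (auto simp: algebra_simps power2_eq_square)
  also have "\<dots> = \<eta> (1 - \<mu>) * jacobi_sum + \<eta> (1 + \<mu>) * jacobi_sum"
    unfolding sum.distrib sum_chi_eta_shift[OF nz(1)] sum_chi_eta_shift[OF nz(2)] ..
  finally show ?thesis by (simp add: algebra_simps)
qed

text \<open>The substitution \<open>y = \<delta> * z - a\<close> carries the roots, the negated
  conjugates of \<open>a\<close>, to 0, 1 and \<open>\<mu> ^ 2\<close>.\<close>

lemma norm_sum_eq_jacobi:
  assumes "a \<notin> F"
  obtains u where "norm u = 1" "Re u \<in> \<int>" "Im u \<in> \<int>" "norm_sum a = 2 * u * jacobi_sum"
proof -
  define \<delta> where "\<delta> = a - a ^ q"
  have \<delta>0: "\<delta> \<noteq> 0" using assms by (auto simp: \<delta>_def simp flip: power_q_eq_iff)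
  have \<delta>q: "\<delta> ^ q = a ^ q - (a ^ q) ^ q" and \<delta>qq: "(\<delta> ^ q) ^ q = (a ^ q) ^ q - a"
    by (simp_all add: \<delta>_def frob_diff)
  obtain \<iota> :: 'a where \<iota>: "\<iota> ^ 2 = -1" using minus_1_square by blast
  have "odd q" using q_mod_4 by presburger
  then have "even (q ^ 2 - 1)" using q_gt_1 by simp
  then obtain m where m: "q ^ 2 - 1 = m * 2" by (metis dvd_def mult.commute)
  \<comment> \<open>The third root is \<open>- (\<delta> ^ (q ^ 2 - 1))\<close>; it is a square
    because -1 is one and the exponent is even.\<close>
  define \<mu> where "\<mu> = \<iota> * \<delta> ^ m"
  have "\<mu> ^ 2 = - (\<delta> ^ (q ^ 2 - 1))" unfolding m by (simp add: \<mu>_def power_mult_distrib \<iota> power_mult)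
  moreover have "\<delta> ^ (q ^ 2 - 1) = (\<delta> ^ q) ^ q / \<delta>"
    using \<delta>0 q_gt_1 by (simp add: power_diff power2_eq_square flip: power_mult)
  ultimately have \<mu>2: "\<mu> ^ 2 = (a - (a ^ q) ^ q) / \<delta>" by (simp only: \<delta>qq minus_divide_left minus_diff_eq)
  have \<mu>0: "\<mu> \<noteq> 0" using \<delta>0 \<iota> by (auto simp: \<mu>_def)
  have 1: "1 - \<mu> ^ 2 = - (\<delta> ^ q) / \<delta>" using \<delta>0 by (simp add: \<mu>2 \<delta>q field_simps) (simp add: \<delta>_def)
  then have \<mu>1: "\<mu> ^ 2 \<noteq> 1" using \<delta>0 by auto
  \<comment> \<open>Since \<open>\<delta> ^ q\<close> and \<open>\<delta>\<close> have equal
    \<open>\<eta>\<close>, the two Jacobi contributions agree in sign and double instead of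
    cancelling.\<close>
  have "\<eta> (1 - \<mu> ^ 2) = 1"
  proof -
    have "\<eta> (-1) = 1" using \<iota> eta_square[of \<iota>] by (cases "\<iota> = 0") auto
    moreover have "\<eta> (\<delta> ^ q) = \<eta> \<delta>" by (simp add: \<eta>_def chi_frob)
    moreover have "- (\<delta> ^ q) / \<delta> = (-1) * \<delta> ^ q * \<delta> * inverse \<delta> ^ 2"
      using \<delta>0 by (simp add: power2_eq_square field_simps)
    ultimately show ?thesis using \<delta>0 eta_square[of "inverse \<delta>"] eta_sq[of \<delta>] unfolding 1
      by (simp only: eta_mult) simp
  qed
  moreover have "1 - \<mu> ^ 2 = (1 - \<mu>) * (1 + \<mu>)" by (simp add: power2_eq_square algebra_simps)
  ultimately have prod: "\<eta> (1 - \<mu>) * \<eta> (1 + \<mu>) = 1" by (simp add: eta_mult)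
  then have nz: "1 - \<mu> \<noteq> 0" by (metis eta_0 mult_zero_left zero_neq_one)
  from prod have "1 + \<mu> \<noteq> 0" by (metis eta_0 mult_zero_right zero_neq_one)
  with prod eta_cases[OF nz] eta_cases[of "1 + \<mu>"] have eq: "\<eta> (1 + \<mu>) = \<eta> (1 - \<mu>)" by auto
  have "norm_sum a = (\<Sum>y\<in>UNIV. \<chi> (\<delta> ^ 3 * (y * (y - 1) * (y - \<mu> ^ 2))))"
    unfolding norm_sum_def
  proof (rule sum.reindex_bij_witness[of _ "\<lambda>y. \<delta> * y - a" "\<lambda>y. (y + a) / \<delta>"])
    fix y
    have "\<delta> * \<mu> ^ 2 = a - (a ^ q) ^ q" using \<delta>0 by (simp add: \<mu>2)
    moreover have "\<delta> ^ 3 * ((y + a) / \<delta> * ((y + a) / \<delta> - 1) * ((y + a) / \<delta> - \<mu> ^ 2)) = (y + a) * (y + a - \<delta>) * (y + a - \<delta> * \<mu> ^ 2)"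
      using \<delta>0 by (simp add: field_simps power3_eq_cube)
    ultimately show "\<chi> (\<delta> ^ 3 * ((y + a) / \<delta> * ((y + a) / \<delta> - 1) * ((y + a) / \<delta> - \<mu> ^ 2))) = \<chi> ((y + a) * (y + a ^ q) * (y + (a ^ q) ^ q))"
      by (simp add: \<delta>_def)
  qed (use \<delta>0 in auto)
  also have "\<dots> = \<chi> (\<delta> ^ 3) * ((\<eta> (1 - \<mu>) + \<eta> (1 + \<mu>)) * jacobi_sum)"
    unfolding sum_chi_legendre[OF \<mu>0 \<mu>1, symmetric] by (simp add: chi_mult[of "\<delta> ^ 3"] sum_distrib_left)
  also have "\<dots> = 2 * \<chi> (\<delta> ^ 3 * (1 - \<mu>) ^ 2) * jacobi_sum"
    unfolding eq by (simp add: \<eta>_def chi_mult chi_power)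
  finally have res: "norm_sum a = 2 * \<chi> (\<delta> ^ 3 * (1 - \<mu>) ^ 2) * jacobi_sum" .
  have "\<delta> ^ 3 * (1 - \<mu>) ^ 2 \<noteq> 0" using \<delta>0 nz by simp
  from that[OF norm_chi[OF this] _ _ res] chi_cases[OF this] show ?thesis by auto
qed

section \<open>Sums over lines\<close>

lemma chi_gauss_int: "\<chi> x \<in> gauss_int"
proof (cases "x = 0")
  case False
  then show ?thesis using chi_cases[of x] by (auto simp: gauss_int_def)
qed (simp add: gauss_int_def)

lemma Re_Im_sum_chi:
  assumes "finite A" "0 \<notin> A"
  shows "Re (\<Sum>x\<in>A. \<chi> x) + Im (\<Sum>x\<in>A. \<chi> x) = of_int (2 * int (card {x\<in>A. \<chi> x \<in> {1, \<i>}}) - int (card A))"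
proof -
  have "Re (\<Sum>x\<in>A. \<chi> x) + Im (\<Sum>x\<in>A. \<chi> x) = (\<Sum>x\<in>A. Re (\<chi> x) + Im (\<chi> x))"
    by (simp add: sum.distrib)
  also have "\<dots> = (\<Sum>x\<in>A. 2 * (if \<chi> x \<in> {1, \<i>} then 1 else 0) - 1)"
  proof (rule sum.cong[OF refl])
    fix x assume "x \<in> A"
    then have "x \<noteq> 0" using assms by auto
    then show "Re (\<chi> x) + Im (\<chi> x) = 2 * (if \<chi> x \<in> {1, \<i>} then 1 else 0) - 1"
      using chi_cases[of x] by (auto simp: complex_eq_iff)
  qed
  also have "\<dots> = 2 * (\<Sum>x\<in>A. if \<chi> x \<in> {1, \<i>} then 1 else 0) - real (card A)"
    by (simp add: sum_subtractf flip: sum_distrib_left)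
  also have "(\<Sum>x\<in>A. if \<chi> x \<in> {1, \<i>} then 1 else (0::real)) = real (card {x\<in>A. \<chi> x \<in> {1, \<i>}})"
    using assms(1) by (simp add: sum.If_cases Int_def)
  finally show ?thesis by simp
qed

end

section \<open>Characteristic 3: values of the line sums\<close>

locale ternary_cubic_extension = cubic_extension +
  fixes e :: nat
  assumes q_eq: "q = 3 ^ (2 * e)" and e_pos: "e \<ge> 1"
begin

lemma odd_q: "odd q" by (simp add: q_eq)

lemma gauss_int_norm_q_power:
  assumes "z \<in> gauss_int" "(norm z) ^ 2 = real q ^ k"
  obtains u where "u \<in> gauss_int" "norm u = 1" "z = 3 ^ (k * e) * u"
proof -
  have "(9::real) = 3 ^ 2" by simp
  then have "real q ^ k = 9 ^ (k * e)"
    by (simp only: q_eq of_nat_power of_nat_numeral power_mult[symmetric]) (simp add: mult_ac)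
  then have "(norm z) ^ 2 = 9 ^ (k * e)" using assms(2) by simp
  from gauss_int_norm_power_9[OF assms(1) this] show ?thesis using that by blast
qed

lemma line_sum_eq:
  assumes "a \<notin> F"
  obtains x where "x \<in> {1, -1, \<i>, -\<i>}" "line_sum a = 3 ^ e * x"
proof -
  have "quadratic_sum a \<in> gauss_int"
    unfolding quadratic_sum_def by (intro gauss_int_sum) (auto intro: chi_gauss_int)
  moreover have "(norm (quadratic_sum a)) ^ 2 = real q ^ 2" by (simp add: norm_quadratic_sum[OF assms])
  ultimately obtain u where u: "u \<in> gauss_int" "norm u = 1" "quadratic_sum a = 3 ^ (2 * e) * u"
    by (rule gauss_int_norm_q_power)
  have "\<eta> x \<in> gauss_int" for x unfolding \<eta>_def by (intro gauss_int_power chi_gauss_int)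
  then have "jacobi_sum \<in> gauss_int"
    unfolding jacobi_sum_def by (intro gauss_int_sum gauss_int_closed chi_gauss_int)
  then obtain v where v: "v \<in> gauss_int" "norm v = 1" "jacobi_sum = 3 ^ (3 * e) * v"
    using norm_jacobi_sum by (rule gauss_int_norm_q_power)
  obtain w where w: "norm w = 1" "Re w \<in> \<int>" "Im w \<in> \<int>" "norm_sum a = 2 * w * jacobi_sum"
    using norm_sum_eq_jacobi[OF assms] .
  have eq: "line_sum a ^ 3 - 3 * (3 ^ (2 * e) * u) * line_sum a = 2 * (3 ^ (3 * e) * (w * v))"
    using norm_sum_eq[OF assms] w(4) u(3) v(3) by (simp add: mult_ac)
  have wv: "w * v \<in> gauss_int" "norm (w * v) = 1"
    using w v by (auto simp: norm_mult intro: gauss_int_closed) (simp add: gauss_int_def)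
  have B: "line_sum a = (\<Sum>x\<in>(\<lambda>t. a + t) ` F. \<chi> x)"
    unfolding line_sum_def by (subst sum.reindex) auto
  have "0 \<notin> (\<lambda>t. a + t) ` F"
  proof
    assume "0 \<in> (\<lambda>t. a + t) ` F"
    then obtain t where "t \<in> F" "a = - t" by (auto simp: eq_neg_iff_add_eq_0)
    then show False using assms by simp
  qed
  then have "Re (line_sum a) + Im (line_sum a) = of_int (2 * int (card {x \<in> (\<lambda>t. a + t) ` F. \<chi> x \<in> {1, \<i>}}) - int q)"
    unfolding B by (subst Re_Im_sum_chi) (auto simp: card_image card_F)
  \<comment> \<open>The parity of \<open>q\<close> rules out the non-unit solutions of the cubic
    equation.\<close>
  moreover have "odd (2 * int c - int q)" for c using odd_q by simp
  moreover have "line_sum a \<in> gauss_int"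
    unfolding line_sum_def by (intro gauss_int_sum chi_gauss_int)
  ultimately show ?thesis
    using gauss_int_cubic_unit[OF _ u(1,2) wv eq] that by blast
qed

section \<open>Lines of the plane \<open>tr x = 1\<close>\<close>

definition affine_line :: "'a \<Rightarrow> 'a set" where
  "affine_line u = {x. tr x = 1 \<and> tr (u * x) = 0}"

lemma card_affine_line:
  assumes "u \<notin> F"
  shows "card (affine_line u) = q"
  using card_tr_fibre2[of 1 u 1 0] assms by (auto simp: affine_line_def)

text \<open>The direction \<open>d\<close> spans the common kernel of the two functionals. Factoring
  it out of a base point \<open>x0\<close> gives \<open>a = x0 / d\<close>, which is not in
  \<open>F\<close> because \<open>tr x0 = 1\<close> and \<open>tr d = 0\<close>.\<close>

lemma affine_line_param:
  assumes "u \<notin> F"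
  obtains a d where "a \<notin> F" "d \<noteq> 0" "bij_betw (\<lambda>t. d * (a + t)) F (affine_line u)"
proof -
  have "affine_line u \<noteq> {}" using card_affine_line[OF assms] q_gt_1 by auto
  then obtain x0 where x0: "tr x0 = 1" "tr (u * x0) = 0" by (auto simp: affine_line_def)
  obtain d where d: "d \<noteq> 0" "tr d = 0" "tr (u * d) = 0" using tr_common_kernel[OF assms] .
  define a where "a = x0 / d"
  have x0d: "x0 = d * a" using d by (simp add: a_def)
  have "a \<notin> F"
  proof
    assume "a \<in> F"
    then have "tr x0 = a * tr d" using tr_scale[of a d] by (simp add: x0d mult.commute)
    then show False using x0 d by simp
  qed
  have inj: "inj_on (\<lambda>t. d * (a + t)) F" using d by (auto intro: inj_onI)
  have "(\<lambda>t. d * (a + t)) ` F = affine_line u"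
  proof (rule card_seteq)
    show "(\<lambda>t. d * (a + t)) ` F \<subseteq> affine_line u"
    proof clarify
      fix t assume t: "t \<in> F"
      have "tr (d * (a + t)) = tr x0 + t * tr d"
        using tr_add[of x0 "t * d"] tr_scale[OF t, of d] by (simp add: x0d algebra_simps)
      moreover have "tr (u * (d * (a + t))) = tr (u * x0) + t * tr (u * d)"
        using tr_add[of "u * x0" "t * (u * d)"] tr_scale[OF t, of "u * d"] by (simp add: x0d algebra_simps)
      ultimately show "d * (a + t) \<in> affine_line u" using x0 d by (simp add: affine_line_def)
    qed
    show "card (affine_line u) \<le> card ((\<lambda>t. d * (a + t)) ` F)"
      by (simp add: card_affine_line[OF assms] card_image[OF inj] card_F)
  qed simp
  then show ?thesis using that[of a d] \<open>a \<notin> F\<close> d(1) inj by (simp add: bij_betw_def)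
qed

text \<open>For \<open>u\<close> outside \<open>F\<close> this is the number of selected points on
  the line minus the number of the others.\<close>

definition line_excess :: "'a \<Rightarrow> int" where
  "line_excess u = 2 * int (card {x \<in> affine_line u. \<chi> x \<in> {1, \<i>}}) - int q"

lemma line_excess_eq:
  assumes "u \<notin> F"
  shows "of_int (line_excess u) = Re (\<Sum>x\<in>affine_line u. \<chi> x) + Im (\<Sum>x\<in>affine_line u. \<chi> x)"
  unfolding line_excess_def
  by (subst Re_Im_sum_chi) (auto simp: card_affine_line[OF assms], simp add: affine_line_def)

lemma line_excess_cases:
  assumes "u \<notin> F"
  shows "line_excess u = 3 ^ e \<or> line_excess u = - (3 ^ e)"
proof -
  obtain a d where ad: "a \<notin> F" "d \<noteq> 0" "bij_betw (\<lambda>t. d * (a + t)) F (affine_line u)"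
    using affine_line_param[OF assms] .
  obtain x where x: "x \<in> {1, -1, \<i>, -\<i>}" "line_sum a = 3 ^ e * x" using line_sum_eq[OF ad(1)] .
  have "(\<Sum>x\<in>affine_line u. \<chi> x) = \<chi> d * line_sum a"
    unfolding line_sum_def sum.reindex_bij_betw[OF ad(3), symmetric] by (simp add: chi_mult sum_distrib_left)
  also have "\<dots> = of_nat (3 ^ e) * (\<chi> d * x)" by (simp add: x(2))
  finally have "(\<Sum>x\<in>affine_line u. \<chi> x) = of_nat (3 ^ e) * (\<chi> d * x)" .
  moreover have "\<chi> d * x \<in> {1, -1, \<i>, -\<i>}" using chi_cases[OF ad(2)] x(1) by auto
  ultimately have "real_of_int (line_excess u) = real (3 ^ e) \<or> real_of_int (line_excess u) = - real (3 ^ e)"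
    using Re_Im_unit_mult[of "\<chi> d * x" "3 ^ e"] line_excess_eq[OF assms] by metis
  then have "real_of_int (line_excess u) = of_int (3 ^ e) \<or> real_of_int (line_excess u) = of_int (- (3 ^ e))" by simp
  then show ?thesis by (simp only: of_int_eq_iff)
qed

end

section \<open>The cyclic model\<close>

locale cyclic_affine_plane = ternary_cubic_extension +
  fixes w1 :: 'a
  assumes w1_order: "has_mult_order w1 N"
begin

lemma w1_nonzero [simp]: "w1 \<noteq> 0"
  using w1_order by (auto simp: has_mult_order_def power_0_left)

text \<open>\<open>N\<close> is 3 modulo \<open>q - 1\<close>, and 3 divides \<open>q\<close>, hence
  not \<open>q - 1\<close>.\<close>

lemma coprime_N: "coprime N (q - 1)"
proof -
  obtain p where p: "q = Suc p" using q_gt_1 by (cases q) auto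
  have N: "N = 3 + (p + 3) * p" by (simp add: N_def p power2_eq_square algebra_simps)
  have "3 dvd Suc p" using e_pos by (simp add: q_eq flip: p)
  then have "\<not> 3 dvd p" by presburger
  moreover have "prime (3::nat)" by simp
  ultimately have "coprime 3 p" by (metis prime_imp_coprime)
  then have "coprime N p" unfolding N by (metis coprime_iff_gcd_eq_1 gcd.commute gcd_add_mult mult.commute add.commute)
  then show ?thesis by (simp add: p)
qed

text \<open>Coprimality of \<open>N\<close> and \<open>q - 1\<close> keeps the powers of
  \<open>w1\<close> below \<open>N\<close> in distinct classes modulo \<open>F - {0}\<close>, and
  counting shows that they represent every projective point.\<close>

lemma w1_decomposition:
  "bij_betw (\<lambda>(c, j). c * w1 ^ j) ((F - {0}) \<times> {..<N}) (UNIV - {0})"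
proof -
  let ?f = "\<lambda>(c, j). c * w1 ^ j" and ?D = "(F - {0}) \<times> {..<N}"
  have *: "i = j" if "c \<in> F - {0}" "d \<in> F - {0}" "i \<le> j" "j < N" "c * w1 ^ i = d * w1 ^ j" for c d i j
  proof -
    have "w1 ^ j = w1 ^ i * w1 ^ (j - i)" using that by (simp flip: power_add)
    then have "w1 ^ (j - i) = c / d" using that by (simp add: field_simps)
    then have "(w1 ^ (j - i)) ^ q = w1 ^ (j - i)" using that by simp
    then have "(w1 ^ (j - i)) ^ (q - 1) = 1" using q_gt_1 by (simp add: power_diff)
    then have "N dvd (j - i) * (q - 1)"
      using has_mult_order_power_eq_1_iff[OF w1_order, of "(j - i) * (q - 1)"] by (simp add: power_mult)
    then have "N dvd j - i" using coprime_N by (simp add: coprime_dvd_mult_left_iff)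
    then show ?thesis using that by (metis diff_is_0_eq' dvd_imp_le le_antisym less_imp_diff_less linorder_not_le neq0_conv diff_is_0_eq)
  qed
  have inj: "inj_on ?f ?D"
  proof (rule inj_onI)
    fix x y assume xy: "x \<in> ?D" "y \<in> ?D" "?f x = ?f y"
    obtain c i d j where x: "x = (c, i)" and y: "y = (d, j)" by (metis surj_pair)
    have "i = j"
    proof (cases "i \<le> j")
      case True
      then show ?thesis using *[of c d i j] xy by (auto simp: x y)
    next
      case False
      then show ?thesis using *[of d c j i] xy by (auto simp: x y)
    qed
    then show "x = y" using xy(3) by (simp add: x y)
  qed
  have "?f ` ?D = UNIV - {0}"
  proof (rule card_seteq)
    have "card ?D = q ^ 3 - 1" unfolding order_factor by (simp add: card_cartesian_product card_Diff_subset card_F)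
    then show "card (UNIV - {0::'a}) \<le> card (?f ` ?D)"
      by (simp add: card_image[OF inj] card_Diff_subset card_E)
  qed auto
  then show ?thesis using inj by (simp add: bij_betw_def)
qed

lemma w1_decomposition_ex:
  assumes "x \<noteq> 0"
  obtains c j where "c \<in> F" "c \<noteq> 0" "j < N" "x = c * w1 ^ j"
proof -
  have "x \<in> (\<lambda>(c, j). c * w1 ^ j) ` ((F - {0}) \<times> {..<N})"
    unfolding bij_betw_imp_surj_on[OF w1_decomposition] using assms by simp
  then show ?thesis using that by auto
qed

lemma w1_decomposition_unique:
  assumes "c \<in> F" "c \<noteq> 0" "j < N" "d \<in> F" "d \<noteq> 0" "i < N" "c * w1 ^ j = d * w1 ^ i"
  shows "j = i"
  using inj_onD[OF bij_betw_imp_inj_on[OF w1_decomposition], of "(c, j)" "(d, i)"] assms by auto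

lemma w1_power_notin_F:
  assumes "i \<in> {1..N - 1}"
  shows "w1 ^ i \<notin> F"
proof
  assume "w1 ^ i \<in> F"
  then have "i = 0" using w1_decomposition_unique[of 1 i "w1 ^ i" 0] assms by (auto simp: N_def)
  then show False using assms by simp
qed

text \<open>\<open>N\<close> is 3 modulo 4, so \<open>\<chi> w1\<close> has both cube and fourth
  power equal to 1.\<close>

lemma chi_w1_power [simp]: "\<chi> (w1 ^ j) = 1"
proof -
  obtain m where m: "q = 4 * m + 1" using q_mod_4 by (metis div_mult_mod_eq mult.commute)
  have N: "N = 4 * (4 * m * m + 3 * m) + 3" by (simp add: N_def m power2_eq_square algebra_simps)
  have "\<chi> w1 ^ N = (\<chi> w1 ^ 4) ^ (4 * m * m + 3 * m) * \<chi> w1 ^ 3"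
    by (subst N) (simp only: power_add[of _ _ 3] power_mult[of _ 4])
  moreover have "\<chi> w1 ^ N = 1" using w1_order chi_power[of w1 N] by (simp add: has_mult_order_def)
  ultimately have 3: "\<chi> w1 ^ 3 = 1" using chi_power_4[OF w1_nonzero] by simp
  have "\<chi> w1 ^ 4 = \<chi> w1 ^ 3 * \<chi> w1" by (simp add: numeral_eq_Suc)
  then have "\<chi> w1 = 1" using 3 chi_power_4[OF w1_nonzero] by simp
  then show ?thesis by (simp add: chi_power)
qed

text \<open>The representative of an affine point on the plane \<open>tr x = 1\<close>. At infinity
  \<open>inverse 0 = 0\<close> makes it 0.\<close>

definition pt :: "nat \<Rightarrow> 'a" where "pt j = inverse (tr (w1 ^ j)) * w1 ^ j"

lemma tr_pt_mult: "tr (u * pt j) = inverse (tr (w1 ^ j)) * tr (u * w1 ^ j)"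
  using tr_scale[of "inverse (tr (w1 ^ j))" "u * w1 ^ j"] by (simp add: pt_def mult.left_commute)

lemma bij_pt: "bij_betw pt {j \<in> {..<N}. tr (w1 ^ j) \<noteq> 0} {x. tr x = 1}"
  unfolding bij_betw_def
proof
  show "inj_on pt {j \<in> {..<N}. tr (w1 ^ j) \<noteq> 0}"
    by (rule inj_onI) (auto simp: pt_def dest!: w1_decomposition_unique[rotated 6])
  show "pt ` {j \<in> {..<N}. tr (w1 ^ j) \<noteq> 0} = {x. tr x = 1}"
  proof
    show "pt ` {j \<in> {..<N}. tr (w1 ^ j) \<noteq> 0} \<subseteq> {x. tr x = 1}"
      using tr_pt_mult[of 1] by auto
    show "{x. tr x = 1} \<subseteq> pt ` {j \<in> {..<N}. tr (w1 ^ j) \<noteq> 0}"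
    proof clarify
      fix x assume x: "tr x = 1"
      then have "x \<noteq> 0" by auto
      then obtain c j where cj: "c \<in> F" "c \<noteq> 0" "j < N" "x = c * w1 ^ j" using w1_decomposition_ex by blast
      have "c * tr (w1 ^ j) = 1" using x cj by (simp add: tr_scale)
      then have "tr (w1 ^ j) \<noteq> 0" "c = inverse (tr (w1 ^ j))"
        using inverse_unique[of "tr (w1 ^ j)" c] by (auto simp: mult.commute)
      then show "x \<in> pt ` {j \<in> {..<N}. tr (w1 ^ j) \<noteq> 0}"
        using cj by (auto simp: pt_def)
    qed
  qed
qed

lemma chi_pt: "\<chi> (pt j) = cnj (\<chi> (tr (w1 ^ j)))"
  by (simp add: pt_def chi_mult chi_inverse)

text \<open>On \<open>F\<close> the character \<open>cnj \<chi>\<close> sends the generator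
  \<open>\<omega> ^ N\<close> to \<open>\<i>\<close>, so its value determines the exponent modulo 4.
  The conjugate arises because \<open>pt\<close> divides by the trace.\<close>

lemma cyclotomic_iff:
  assumes "c \<in> F"
  shows "c \<in> cyclotomic_class 4 (\<omega> ^ N) 0 \<union> cyclotomic_class 4 (\<omega> ^ N) 1 \<longleftrightarrow> cnj (\<chi> c) \<in> {1, \<i>}"
proof
  have w: "\<chi> (\<omega> ^ N) = - \<i>" by (simp add: chi_omega_power i_power_N)
  have 4: "(- \<i>) ^ 4 = 1" by (simp add: i_power_4)
  assume "c \<in> cyclotomic_class 4 (\<omega> ^ N) 0 \<union> cyclotomic_class 4 (\<omega> ^ N) 1"
  then obtain j where "c = ((\<omega> ^ N) ^ 4) ^ j \<or> c = \<omega> ^ N * ((\<omega> ^ N) ^ 4) ^ j"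
    by (auto simp: cyclotomic_class_def)
  moreover have "\<chi> (((\<omega> ^ N) ^ 4) ^ j) = 1"
    by (simp only: chi_power[of _ j] chi_power[of _ 4] w 4 power_one)
  ultimately have "\<chi> c = 1 \<or> \<chi> c = - \<i>" using w by (auto simp: chi_mult)
  then show "cnj (\<chi> c) \<in> {1, \<i>}" by auto
next
  have w: "\<chi> (\<omega> ^ N) = - \<i>" by (simp add: chi_omega_power i_power_N)
  have 4: "(- \<i>) ^ 4 = 1" by (simp add: i_power_4)
  assume c: "cnj (\<chi> c) \<in> {1, \<i>}"
  then have "c \<noteq> 0" by auto
  then obtain m where m: "c = (\<omega> ^ N) ^ m" using frob_fixed_omega_power[of c] assms by auto
  have "c = (\<omega> ^ N) ^ (m mod 4 + 4 * (m div 4))" by (simp add: m)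
  then have mm: "c = (\<omega> ^ N) ^ (m mod 4) * ((\<omega> ^ N) ^ 4) ^ (m div 4)"
    by (simp only: power_add power_mult)
  have "\<chi> c = (- \<i>) ^ (m mod 4)"
    by (subst mm) (simp only: chi_mult chi_power[of _ "m div 4"] chi_power[of _ 4] chi_power[of _ "m mod 4"] w 4 power_one mult_1_right)
  moreover have "m mod 4 = 0 \<or> m mod 4 = 1 \<or> m mod 4 = 2 \<or> m mod 4 = 3" by presburger
  ultimately have "m mod 4 = 0 \<or> m mod 4 = 1"
    using c by (elim disjE) (simp_all add: complex_eq_iff power3_eq_cube)
  then show "c \<in> cyclotomic_class 4 (\<omega> ^ N) 0 \<union> cyclotomic_class 4 (\<omega> ^ N) 1"
    using mm unfolding cyclotomic_class_def by auto
qed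

definition K :: "nat set" where
  "K = {k \<in> {..<N}. tr (w1 ^ k) \<in> cyclotomic_class 4 (\<omega> ^ N) 0 \<union> cyclotomic_class 4 (\<omega> ^ N) 1}"

lemma K_eq: "K = {k \<in> {..<N}. tr (w1 ^ k) \<noteq> 0 \<and> \<chi> (pt k) \<in> {1, \<i>}}"
  unfolding K_def using cyclotomic_iff[OF tr_in_F] by (auto simp: chi_pt)

lemma K_subset: "K \<subseteq> ag_points tr N w1"
  by (auto simp: K_eq ag_points_def ag_infinity_def)

lemma card_line_K: "card (ag_line tr N w1 i \<inter> K) = card {x \<in> affine_line (w1 ^ i). \<chi> x \<in> {1, \<i>}}"
proof -
  have "bij_betw pt (ag_line tr N w1 i \<inter> K) {x \<in> affine_line (w1 ^ i). \<chi> x \<in> {1, \<i>}}"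
    unfolding bij_betw_def
  proof
    show "inj_on pt (ag_line tr N w1 i \<inter> K)"
      by (rule inj_on_subset[OF bij_betw_imp_inj_on[OF bij_pt]]) (auto simp: K_eq)
    have iff: "tr (w1 ^ i * pt j) = 0 \<longleftrightarrow> tr (w1 ^ (i + j)) = 0" if "tr (w1 ^ j) \<noteq> 0" for j
      using that by (simp add: tr_pt_mult power_add)
    show "pt ` (ag_line tr N w1 i \<inter> K) = {x \<in> affine_line (w1 ^ i). \<chi> x \<in> {1, \<i>}}"
    proof
      show "pt ` (ag_line tr N w1 i \<inter> K) \<subseteq> {x \<in> affine_line (w1 ^ i). \<chi> x \<in> {1, \<i>}}"
        using bij_betw_apply[OF bij_pt] iff by (auto simp: K_eq ag_line_def affine_line_def)
      show "{x \<in> affine_line (w1 ^ i). \<chi> x \<in> {1, \<i>}} \<subseteq> pt ` (ag_line tr N w1 i \<inter> K)"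
      proof
        fix x assume x: "x \<in> {x \<in> affine_line (w1 ^ i). \<chi> x \<in> {1, \<i>}}"
        then have "x \<in> pt ` {j \<in> {..<N}. tr (w1 ^ j) \<noteq> 0}"
          unfolding bij_betw_imp_surj_on[OF bij_pt] by (simp add: affine_line_def)
        then obtain j where j: "j < N" "tr (w1 ^ j) \<noteq> 0" "x = pt j" by auto
        then have "j \<in> ag_line tr N w1 i \<inter> K"
          using x iff by (auto simp: K_eq ag_line_def ag_points_def ag_infinity_def affine_line_def)
        then show "x \<in> pt ` (ag_line tr N w1 i \<inter> K)" using j by blast
      qed
    qed
  qed
  then show ?thesis by (rule bij_betw_same_card)
qed

text \<open>The \<open>q ^ 2 - 1\<close> nonzero vectors orthogonal to \<open>x\<close> under the
  trace form fall into classes of \<open>q - 1\<close> proportional ones, one class for each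
  index.\<close>

lemma card_lines_through:
  assumes "tr x = 1"
  shows "card {i \<in> {1..N - 1}. tr (w1 ^ i * x) = 0} = q + 1"
proof -
  have x: "x \<noteq> 0" using assms by auto
  let ?I = "{i \<in> {..<N}. tr (w1 ^ i * x) = 0}"
  \<comment> \<open>Index 0 is the line at infinity; it does not occur since
    \<open>tr x = 1\<close>.\<close>
  have I: "{i \<in> {1..N - 1}. tr (w1 ^ i * x) = 0} = ?I"
    using assms by (auto simp: N_def) (metis One_nat_def Suc_leI gr0I mult_1 power_0 zero_neq_one)
  have "bij_betw (\<lambda>(c, j). c * w1 ^ j) ((F - {0}) \<times> ?I) ({y. tr (x * y) = 0} - {0})"
    unfolding bij_betw_def
  proof
    have scale: "tr (x * (c * w1 ^ j)) = c * tr (w1 ^ j * x)" if "c \<in> F" for c j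
      using tr_scale[OF that, of "w1 ^ j * x"] by (simp add: mult_ac)
    show "inj_on (\<lambda>(c, j). c * w1 ^ j) ((F - {0}) \<times> ?I)"
      by (rule inj_on_subset[OF bij_betw_imp_inj_on[OF w1_decomposition]]) auto
    show "(\<lambda>(c, j). c * w1 ^ j) ` ((F - {0}) \<times> ?I) = {y. tr (x * y) = 0} - {0}"
    proof
      show "{y. tr (x * y) = 0} - {0} \<subseteq> (\<lambda>(c, j). c * w1 ^ j) ` ((F - {0}) \<times> ?I)"
      proof
        fix y assume y: "y \<in> {y. tr (x * y) = 0} - {0}"
        then obtain c j where "c \<in> F" "c \<noteq> 0" "j < N" "y = c * w1 ^ j" using w1_decomposition_ex by blast
        then show "y \<in> (\<lambda>(c, j). c * w1 ^ j) ` ((F - {0}) \<times> ?I)"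
          using y scale by (intro image_eqI[of _ _ "(c, j)"]) auto
      qed
    qed (auto simp: scale)
  qed
  then have "card ((F - {0}) \<times> ?I) = card ({y. tr (x * y) = 0} - {0})" by (rule bij_betw_same_card)
  then have "(q - 1) * card ?I = q ^ 2 - 1"
    using card_tr_fibre[OF x, of 0] by (simp add: card_cartesian_product card_Diff_subset card_F)
  moreover have "q ^ 2 - 1 = (q - 1) * (q + 1)"
    by (cases q) (auto simp: power2_eq_square)
  ultimately have "(q - 1) * card ?I = (q - 1) * (q + 1)" by (simp only:)
  then have "card ?I = q + 1" using q_gt_1 by (metis nat_mult_eq_cancel1 zero_less_diff)
  then show ?thesis by (simp only: I)
qed

text \<open>Every affine point lies on \<open>q + 1\<close> lines, so the sums over all lines add up
  to \<open>(q + 1) * plane_sum 1\<close>, and inertness of 3 makes the plane sum \<open>q\<close>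
  times a unit.\<close>

lemma sum_line_excess: "\<bar>\<Sum>i\<in>{1..N - 1}. line_excess (w1 ^ i)\<bar> = int ((q + 1) * q)"
proof -
  have "(\<Sum>i\<in>{1..N - 1}. \<Sum>x\<in>affine_line (w1 ^ i). \<chi> x)
      = (\<Sum>i\<in>{1..N - 1}. \<Sum>x | tr x = 1. if tr (w1 ^ i * x) = 0 then \<chi> x else 0)"
    by (rule sum.cong[OF refl], rule sum.mono_neutral_cong_left) (auto simp: affine_line_def)
  also have "\<dots> = (\<Sum>x | tr x = 1. \<Sum>i\<in>{1..N - 1}. if tr (w1 ^ i * x) = 0 then \<chi> x else 0)"
    by (rule sum.swap)
  also have "\<dots> = (\<Sum>x | tr x = 1. of_nat (q + 1) * \<chi> x)"
  proof (rule sum.cong[OF refl])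
    fix x assume "x \<in> {x. tr x = 1}"
    then have "card {i \<in> {1..N - 1}. tr (w1 ^ i * x) = 0} = q + 1" using card_lines_through by simp
    moreover have "(\<Sum>i\<in>{1..N - 1}. if tr (w1 ^ i * x) = 0 then \<chi> x else 0)
        = of_nat (card {i \<in> {1..N - 1}. tr (w1 ^ i * x) = 0}) * \<chi> x"
      by (simp add: sum.If_cases Int_def)
    ultimately show "(\<Sum>i\<in>{1..N - 1}. if tr (w1 ^ i * x) = 0 then \<chi> x else 0) = of_nat (q + 1) * \<chi> x"
      by simp
  qed
  also have "\<dots> = of_nat (q + 1) * plane_sum 1" by (simp add: plane_sum_def sum_distrib_left)
  finally have eq: "(\<Sum>i\<in>{1..N - 1}. \<Sum>x\<in>affine_line (w1 ^ i). \<chi> x) = of_nat (q + 1) * plane_sum 1" .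
  have "plane_sum 1 \<in> gauss_int" unfolding plane_sum_def by (intro gauss_int_sum chi_gauss_int)
  moreover have "(norm (plane_sum 1)) ^ 2 = real q ^ 2" by (simp add: norm_plane_sum_1)
  ultimately obtain u where u: "u \<in> gauss_int" "norm u = 1" "plane_sum 1 = 3 ^ (2 * e) * u"
    by (rule gauss_int_norm_q_power)
  have "real_of_int (\<Sum>i\<in>{1..N - 1}. line_excess (w1 ^ i))
      = Re (\<Sum>i\<in>{1..N - 1}. \<Sum>x\<in>affine_line (w1 ^ i). \<chi> x) + Im (\<Sum>i\<in>{1..N - 1}. \<Sum>x\<in>affine_line (w1 ^ i). \<chi> x)"
    using line_excess_eq[OF w1_power_notin_F] by (simp add: sum.distrib)
  also have "(\<Sum>i\<in>{1..N - 1}. \<Sum>x\<in>affine_line (w1 ^ i). \<chi> x) = of_nat ((q + 1) * q) * u"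
    unfolding eq u(3) by (simp add: q_eq algebra_simps)
  finally have "real_of_int (\<Sum>i\<in>{1..N - 1}. line_excess (w1 ^ i)) = real ((q + 1) * q) \<or>
      real_of_int (\<Sum>i\<in>{1..N - 1}. line_excess (w1 ^ i)) = - real ((q + 1) * q)"
    using Re_Im_unit_mult[OF gauss_int_unit[OF u(1,2)], of "(q + 1) * q"] by metis
  then have "real_of_int (\<Sum>i\<in>{1..N - 1}. line_excess (w1 ^ i)) = of_int (int ((q + 1) * q)) \<or>
      real_of_int (\<Sum>i\<in>{1..N - 1}. line_excess (w1 ^ i)) = of_int (- int ((q + 1) * q))"
    by (simp only: of_int_minus of_int_of_nat_eq)
  then show ?thesis unfolding of_int_eq_iff by (elim disjE) (simp_all only: abs_minus_cancel abs_of_nat)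
qed

text \<open>A constant excess on all \<open>(q + 1) * q\<close> lines would make the total too large
  by the factor \<open>3 ^ e\<close>.\<close>

lemma line_excess_not_constant:
  assumes "\<bar>c\<bar> = 3 ^ e"
  shows "\<exists>i\<in>{1..N - 1}. line_excess (w1 ^ i) \<noteq> c"
proof (rule ccontr)
  assume "\<not> ?thesis"
  then have "(\<Sum>i\<in>{1..N - 1}. line_excess (w1 ^ i)) = int (N - 1) * c" by simp
  then have "int ((q + 1) * q) = \<bar>int (N - 1) * c\<bar>" using sum_line_excess by simp
  moreover have "N - 1 = (q + 1) * q" by (simp add: N_def power2_eq_square)
  ultimately have "int ((q + 1) * q) * 3 ^ e = int ((q + 1) * q)" by (simp only: abs_mult assms abs_of_nat)
  moreover have "int ((q + 1) * q) \<noteq> 0" using q_gt_1 by (simp only: of_nat_eq_0_iff) simp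
  ultimately have "(3::int) ^ e = 1" by (simp only: mult_cancel_left2) blast
  then show False using e_pos by simp
qed

lemma set_of_type_K:
  "set_of_type (ag_points tr N w1) (ag_lines tr N w1)
     ((3 ^ (2 * e) - 3 ^ e) div 2) ((3 ^ (2 * e) + 3 ^ e) div 2) K"
proof -
  let ?r = "(3::nat) ^ e" and ?k = "\<lambda>i. card (ag_line tr N w1 i \<inter> K)"
  have excess: "line_excess (w1 ^ i) = 2 * int (?k i) - int (3 ^ (2 * e))" for i
    using arg_cong[OF q_eq, of int] by (simp only: card_line_K line_excess_def)
  have "?r \<le> 3 ^ (2 * e)" by (simp add: power_increasing)
  have hi: "?k i = (3 ^ (2 * e) + ?r) div 2" if "line_excess (w1 ^ i) = 3 ^ e" for i
  proof -
    have "int (2 * ?k i) = int (3 ^ (2 * e) + ?r)" using that excess[of i] by simp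
    then have "2 * ?k i = 3 ^ (2 * e) + ?r" by (simp only: of_nat_eq_iff)
    then show ?thesis by presburger
  qed
  have lo: "?k i = (3 ^ (2 * e) - ?r) div 2" if "line_excess (w1 ^ i) = - (3 ^ e)" for i
  proof -
    have "int (2 * ?k i) = int (3 ^ (2 * e) - ?r)" using that excess[of i] \<open>?r \<le> 3 ^ (2 * e)\<close> by (simp add: of_nat_diff)
    then have "2 * ?k i = 3 ^ (2 * e) - ?r" by (simp only: of_nat_eq_iff)
    then show ?thesis by presburger
  qed
  have cases: "line_excess (w1 ^ i) = 3 ^ e \<or> line_excess (w1 ^ i) = - (3 ^ e)" if "i \<in> {1..N - 1}" for i
    using line_excess_cases w1_power_notin_F that by blast
  obtain i where i: "i \<in> {1..N - 1}" "line_excess (w1 ^ i) = - (3 ^ e)"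
    using line_excess_not_constant[of "3 ^ e"] cases by (metis abs_numeral power_abs)
  obtain j where j: "j \<in> {1..N - 1}" "line_excess (w1 ^ j) = 3 ^ e"
    using line_excess_not_constant[of "- (3 ^ e)"] cases by (metis abs_minus_cancel abs_numeral power_abs)
  have "?r \<ge> 1" by simp
  then have "(3 ^ (2 * e) - ?r) div 2 < (3 ^ (2 * e) + ?r) div 2"
    using \<open>?r \<le> 3 ^ (2 * e)\<close> by presburger
  moreover have "\<forall>l\<in>ag_lines tr N w1. card (l \<inter> K) = (3 ^ (2 * e) - ?r) div 2 \<or> card (l \<inter> K) = (3 ^ (2 * e) + ?r) div 2"
    unfolding ag_lines_def using cases hi lo by blast
  moreover have "\<exists>l\<in>ag_lines tr N w1. card (l \<inter> K) = (3 ^ (2 * e) - ?r) div 2"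
    using lo[OF i(2)] i(1) unfolding ag_lines_def by blast
  moreover have "\<exists>l\<in>ag_lines tr N w1. card (l \<inter> K) = (3 ^ (2 * e) + ?r) div 2"
    using hi[OF j(2)] j(1) unfolding ag_lines_def by blast
  ultimately show ?thesis using K_subset unfolding set_of_type_def by blast
qed

end

theorem theorem5p3:
  fixes e q N :: nat
    and F :: "'a::{field,finite} set"
    and Tr :: "'a \<Rightarrow> 'a"
    and \<omega> w0 w1 :: 'a
    and K :: "nat set"
  assumes "e \<ge> 1"
    and "q = 3 ^ (2 * e)"
    and "CARD('a) = q ^ 3"
    and "is_subfield F" and "card F = q"
    and "Tr = rel_trace F 3"
    and "N = q ^ 2 + q + 1"
    and "primitive_element \<omega>"
    and "has_mult_order w1 N"
    and "w0 = \<omega> ^ N"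
    and "K = {k \<in> {..<N}. Tr (w1 ^ k) \<in> cyclotomic_class 4 w0 0 \<union> cyclotomic_class 4 w0 1}"
  shows "set_of_type (ag_points Tr N w1) (ag_lines Tr N w1)
           ((3 ^ (2 * e) - 3 ^ e) div 2) ((3 ^ (2 * e) + 3 ^ e) div 2) K"
proof -
  have "CARD('a) = 3 ^ (2 * e * 3)" unfolding assms(2,3) by (simp only: power_mult)
  then have 3: "(3::'a) = 0" by (rule three_eq_0)
  \<comment> \<open>\<open>q\<close> is a power of 9, which is 1 modulo 4.\<close>
  have "q mod 4 = (9 mod 4) ^ e mod 4" unfolding assms(2) power_mult power_mod by simp
  then have "q mod 4 = 1" by simp
  moreover have "q > 1" using assms(1) one_less_power[of "3::nat" "2 * e"] unfolding assms(2) by simp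
  ultimately interpret cyclic_affine_plane F q N \<omega> e w1
    by unfold_locales (use assms frobenius_3[OF 3] in auto)
  have "Tr = tr"
  proof
    fix x
    show "Tr x = tr x" unfolding assms(6) rel_trace_def tr_def assms(5)
      by (simp add: numeral_eq_Suc power_mult)
  qed
  then show ?thesis using set_of_type_K unfolding K_def assms(10,11) by simp
qed

end
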